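(* Assume (A2), (B1), (B2), and let $x^\star(b_n)$ be any measurable choice of an optimal solution of $(\mathrm{P}_{b_n})$. Assume that for every non-empty $\mathcal{K}\subseteq[N]$ the random vector $(\alpha_n^{\mathcal K},G_n)$ converges in distribution on $\Delta_{|\mathcal K|}\times\mathbb{R}^m$ to some $(\alpha^{\mathcal K},G)$. Then $$r_n\big(x^\star(b_n)-x^\star(b)\big)\xrightarrow{D} M(G^{m_0}):=\sum_{\emptyset\ne\mathcal K\subseteq[K]}\mathbb{1}\Big\{G^{m_0}\in H_{\mathcal K}\setminus\bigcup_{k\in[K]\setminus\mathcal K}H_k\Big\}\,\alpha^{\mathcal K}\otimes x(I_{\mathcal K},G)\in\mathbb{R}^d,$$ where $H_1,\dots,H_K\subseteq\mathbb{R}^{m_0}$ are the closed convex cones defined below, each being an intersection of $m-|\{i:x^\star_i(b)>0\}|$ half-spaces through the origin. In particular, if $x^\star(b)$ is nondegenerate, then $K=1$ and $r_n(x^\star(b_n)-x^\star(b))\xrightarrow{D} x(I_1,G)$, which is a linear function of $G$ (Gaussian if $G$ is Gaussian).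
   Context: Setting: $A\in\mathbb{R}^{m\times d}$ of full rank $m\le d$, $b\in\mathbb{R}^m$, $c\in\mathbb{R}^d$. $(\mathrm{P}_\beta)$: $\min c^Tx$ s.t. $Ax=\beta,x\ge0$; $(\mathrm{D}_\beta)$: $\max\beta^T\lambda$ s.t. $A^T\lambda\le c$. A basis is $I\subseteq[d]$ with $|I|=m$, $A_I$ invertible; for $v\in\mathbb{R}^m$, $x(I,v)\in\mathbb{R}^d$ has coordinates $(A_I)^{-1}v$ on $I$ (in increasing order of indices) and $0$ elsewhere (linear in $v$); $\lambda(I)=(A_I)^{-T}c_I$; $I$ is dual feasible if $A^T\lambda(I)\le c$. Let $I_1,\dots,I_N$ enumerate all dual feasible bases, ordered so that $I_1,\dots,I_K$ are exactly those with $x(I_k,b)\ge 0$. (A2): $(\mathrm{P}_b)$ has a unique optimal solution $x^\star(b)$ (so $x(I_k,b)=x^\star(b)$ for $k\le K$). A basic solution is nondegenerate if it has $m$ nonzero coordinates. Stochastic setting: $r_n>0$, $r_n\to\infty$; $m_0\in\{1,\dots,m\}$; random vectors $b_n=(b_n^{m_0},b_{m_0+1},\dots,b_m)\in\mathbb{R}^m$ (only the first $m_0$ coordinates are random). (B1): $G_n:=r_n(b_n-b)\xrightarrow{D}G=(G^{m_0},0_{m-m_0})$ where $G^{m_0}$ is absolutely continuous w.r.t. Lebesgue measure on $\mathbb{R}^{m_0}$. (B2): $\mathbb{P}((\mathrm{P}_{b_n})\text{ has an optimal solution})\to1$. Weights: for non-empty $\mathcal K\subseteq[N]$ let $A_n^{\mathcal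 K}$ be the event $\{x(I_k,b_n)\ge0\iff k\in\mathcal K\}$; on this event $x^\star(b_n)=\sum_{k\in\mathcal K}(\alpha_n^{\mathcal K})_kx(I_k,b_n)$ for a random vector $\alpha_n^{\mathcal K}$ in the unit simplex $\Delta_{|\mathcal K|}=\{\alpha\in\mathbb{R}_+^{|\mathcal K|}:\|\alpha\|_1=1\}$ (defined arbitrarily but measurably off this event). Notation: $\alpha\otimes x(I_{\mathcal K},v):=\sum_{k\in\mathcal K}\alpha_kx(I_k,v)$. Cones: let $\mathrm{Pos}=\{i:x^\star_i(b)>0\}$; for $k\le K$ write $I_k=\{i^k_1<\dots<i^k_m\}$ and $J_k=\{j\in[m]:i^k_j\notin\mathrm{Pos}\}$; $H_k=\{v\in\mathbb{R}^{m_0}:[(A_{I_k})^{-1}(v,0_{m-m_0})]_j\ge0\ \forall j\in J_k\}$, and $H_{\mathcal K}=\bigcap_{k\in\mathcal K}H_k$. *)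

theory Defs
  imports "HOL-Probability.Probability"
begin

text \<open>Conventions. Vectors of R^k are functions nat => real that vanish from index k on;
matrices A in R^(m x d) are functions nat => nat => real (entries A i j with i < m, j < d).
All indices are 0-based: [d] = {..<d}, [N] = {..<N}, and I_1,...,I_N is Ib 0, ..., Ib (N-1).\<close>

definition vecs :: "nat \<Rightarrow> (nat \<Rightarrow> real) set" where
  "vecs k = {x. \<forall>i\<ge>k. x i = 0}"

definition full_row_rank :: "(nat \<Rightarrow> nat \<Rightarrow> real) \<Rightarrow> nat \<Rightarrow> nat \<Rightarrow> bool" where
  "full_row_rank A m d \<longleftrightarrow>
     (\<forall>y \<in> vecs m. (\<forall>j<d. (\<Sum>i<m. y i * A i j) = 0) \<longrightarrow> y = (\<lambda>_. 0))"

definition lp_feasible :: "(nat \<Rightarrow> nat \<Rightarrow> real) \<Rightarrow> nat \<Rightarrow> nat \<Rightarrow> (nat \<Rightarrow> real) \<Rightarrow> (nat \<Rightarrow> real) \<Rightarrow> bool" where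
  "lp_feasible A m d \<beta> x \<longleftrightarrow> x \<in> vecs d \<and> (\<forall>j<d. 0 \<le> x j) \<and>
     (\<forall>i<m. (\<Sum>j<d. A i j * x j) = \<beta> i)"

definition lp_optimal :: "(nat \<Rightarrow> nat \<Rightarrow> real) \<Rightarrow> (nat \<Rightarrow> real) \<Rightarrow> nat \<Rightarrow> nat \<Rightarrow> (nat \<Rightarrow> real) \<Rightarrow> (nat \<Rightarrow> real) \<Rightarrow> bool" where
  "lp_optimal A c m d \<beta> x \<longleftrightarrow> lp_feasible A m d \<beta> x \<and>
     (\<forall>y. lp_feasible A m d \<beta> y \<longrightarrow> (\<Sum>j<d. c j * x j) \<le> (\<Sum>j<d. c j * y j))"

text \<open>The (unique, under (A2)) optimal solution x*(beta).\<close>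
definition xstar :: "(nat \<Rightarrow> nat \<Rightarrow> real) \<Rightarrow> (nat \<Rightarrow> real) \<Rightarrow> nat \<Rightarrow> nat \<Rightarrow> (nat \<Rightarrow> real) \<Rightarrow> (nat \<Rightarrow> real)" where
  "xstar A c m d \<beta> = (THE x. lp_optimal A c m d \<beta> x)"

definition is_inverse :: "nat \<Rightarrow> (nat \<Rightarrow> nat \<Rightarrow> real) \<Rightarrow> (nat \<Rightarrow> nat \<Rightarrow> real) \<Rightarrow> bool" where
  "is_inverse k B C \<longleftrightarrow>
     (\<forall>i<k. \<forall>j<k. (\<Sum>l<k. B i l * C l j) = (if i = j then 1 else 0)) \<and>
     (\<forall>i<k. \<forall>j<k. (\<Sum>l<k. C i l * B l j) = (if i = j then 1 else 0))"

definition invertible_sq :: "nat \<Rightarrow> (nat \<Rightarrow> nat \<Rightarrow> real) \<Rightarrow> bool" where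
  "invertible_sq k B \<longleftrightarrow> (\<exists>C. is_inverse k B C)"

definition inv_sq :: "nat \<Rightarrow> (nat \<Rightarrow> nat \<Rightarrow> real) \<Rightarrow> (nat \<Rightarrow> nat \<Rightarrow> real)" where
  "inv_sq k B = (SOME C. is_inverse k B C)"

definition idx :: "nat set \<Rightarrow> nat \<Rightarrow> nat" where
  "idx I j = sorted_list_of_set I ! j"

definition colsub :: "(nat \<Rightarrow> nat \<Rightarrow> real) \<Rightarrow> nat set \<Rightarrow> (nat \<Rightarrow> nat \<Rightarrow> real)" where
  "colsub A I = (\<lambda>i j. A i (idx I j))"

definition is_basis :: "(nat \<Rightarrow> nat \<Rightarrow> real) \<Rightarrow> nat \<Rightarrow> nat \<Rightarrow> nat set \<Rightarrow> bool" where
  "is_basis A m d I \<longleftrightarrow> I \<subseteq> {..<d} \<and> card I = m \<and> invertible_sq m (colsub A I)"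

text \<open>x(I,v): coordinates (A_I)^{-1} v on I (in increasing order of indices), 0 elsewhere.
The position of i in I is card {j in I. j < i}.\<close>
definition xsol :: "(nat \<Rightarrow> nat \<Rightarrow> real) \<Rightarrow> nat \<Rightarrow> nat set \<Rightarrow> (nat \<Rightarrow> real) \<Rightarrow> (nat \<Rightarrow> real)" where
  "xsol A m I v = (\<lambda>i. if i \<in> I then
       (\<Sum>l<m. inv_sq m (colsub A I) (card {j\<in>I. j < i}) l * v l) else 0)"

definition dual_sol :: "(nat \<Rightarrow> nat \<Rightarrow> real) \<Rightarrow> (nat \<Rightarrow> real) \<Rightarrow> nat \<Rightarrow> nat set \<Rightarrow> (nat \<Rightarrow> real)" where
  "dual_sol A c m I = (\<lambda>i. if i < m then
       (\<Sum>l<m. inv_sq m (colsub A I) l i * c (idx I l)) else 0)"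

definition dual_feasible_basis :: "(nat \<Rightarrow> nat \<Rightarrow> real) \<Rightarrow> (nat \<Rightarrow> real) \<Rightarrow> nat \<Rightarrow> nat \<Rightarrow> nat set \<Rightarrow> bool" where
  "dual_feasible_basis A c m d I \<longleftrightarrow> is_basis A m d I \<and>
     (\<forall>j<d. (\<Sum>i<m. A i j * dual_sol A c m I i) \<le> c j)"

definition nonneg_vec :: "nat \<Rightarrow> (nat \<Rightarrow> real) \<Rightarrow> bool" where
  "nonneg_vec d x \<longleftrightarrow> (\<forall>i<d. 0 \<le> x i)"

definition nondegenerate :: "nat \<Rightarrow> nat \<Rightarrow> (nat \<Rightarrow> real) \<Rightarrow> bool" where
  "nondegenerate m d x \<longleftrightarrow> card {i\<in>{..<d}. x i \<noteq> 0} = m"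

definition simplex_on :: "nat set \<Rightarrow> (nat \<Rightarrow> real) set" where
  "simplex_on K = {\<alpha>. (\<forall>k\<in>K. 0 \<le> \<alpha> k) \<and> (\<Sum>k\<in>K. \<alpha> k) = 1 \<and> (\<forall>k. k \<notin> K \<longrightarrow> \<alpha> k = 0)}"

definition otimes :: "(nat \<Rightarrow> nat \<Rightarrow> real) \<Rightarrow> nat \<Rightarrow> (nat \<Rightarrow> nat set) \<Rightarrow> nat set \<Rightarrow> (nat \<Rightarrow> real) \<Rightarrow> (nat \<Rightarrow> real) \<Rightarrow> (nat \<Rightarrow> real)" where
  "otimes A m Ib K \<alpha> v = (\<lambda>i. \<Sum>k\<in>K. \<alpha> k * xsol A m (Ib k) v i)"

text \<open>Cones H_k subset R^{m0}: Pos = {i. x*_i(b) > 0}, J_k = {j. i^k_j notin Pos}.\<close>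
definition Hcone :: "(nat \<Rightarrow> nat \<Rightarrow> real) \<Rightarrow> nat \<Rightarrow> nat \<Rightarrow> nat set \<Rightarrow> nat set \<Rightarrow> (nat \<Rightarrow> real) set" where
  "Hcone A m m0 Pos I = {v \<in> vecs m0. \<forall>j<m. idx I j \<notin> Pos \<longrightarrow>
       0 \<le> (\<Sum>l<m. inv_sq m (colsub A I) j l * v l)}"

definition conv_distr :: "'a measure \<Rightarrow> (nat \<Rightarrow> 'a \<Rightarrow> 'c::topological_space) \<Rightarrow> 'b measure \<Rightarrow> ('b \<Rightarrow> 'c) \<Rightarrow> bool" where
  "conv_distr M X N Y \<longleftrightarrow>
     (\<forall>f::'c \<Rightarrow> real. continuous_on UNIV f \<and> bounded (range f) \<longrightarrow>
        (\<lambda>n. \<integral>\<omega>. f (X n \<omega>) \<partial>M) \<longlonglongrightarrow> (\<integral>\<eta>. f (Y \<eta>) \<partial>N))"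

end

theory Submission
  imports Defs
begin

text \<open>The scaled error is governed by which dual feasible bases are primal feasible for \<open>b\<^sub>n\<close>.
  If \<open>(P\<^sub>\<beta>)\<close> is solvable, some dual feasible basis is primal feasible (Farkas' lemma, a dual optimum with
  a spanning set of active constraints, and a primal optimum of minimal support).
  Once \<open>b\<^sub>n\<close> is close to \<open>b\<close>, only bases \<open>I\<^sub>k\<close> with \<open>k \<le> K\<close> can be feasible, and \<open>I\<^sub>k\<close> is feasible iff \<open>G\<^sub>n\<close> lies
  in the cone \<open>H\<^sub>k\<close>. On this event of probability tending to 1 the scaled error is
  \<open>\<alpha>\<^sub>n \<otimes> x(I, G\<^sub>n)\<close> for the pattern of cones containing \<open>G\<^sub>n\<close>. The expectation of a bounded
  continuous function of it is thus a finite sum over patterns of expectations of functions of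
  \<open>(\<alpha>\<^sub>n, G\<^sub>n)\<close> that are discontinuous only where \<open>G\<^sub>n\<close> lies on finitely many hyperplanes. The limit \<open>G\<close>
  avoids these almost surely, so the mapping theorem applies to each summand.\<close>

section \<open>Farkas lemma and inverse matrices\<close>

text \<open>The joint limits are given for one set \<open>K\<close> at a time, and nothing links the
  weights of different sets, so no mapping theorem applies to all weights at once. Since each point
  has exactly one pattern, \<open>f\<close> of the error is a sum of indicators times values of
  \<open>f\<close>, each involving a single weight vector; linearity of the integral then asks for
  no joint law. The indicators have to be almost surely continuous at \<open>G\<close>. Absolute
  continuity covers only the first \<open>m0\<close> coordinates, while a row of an inverse basis
  matrix may vanish on all of them; \<open>G\<close> then meets that constraint with equality.
  Truncating each row to \<open>m0\<close> entries turns such a row into the constraint 0 \<le> 0,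
  which holds everywhere, and every other row into a genuine hyperplane, which \<open>G\<close>
  avoids. That \<open>bn\<close> approaches \<open>b\<close> in probability is derived: by
  \<open>B1\<close> the scaled perturbation is tight, and \<open>r\<close> tends to
  infinity.\<close>

lemma sum_unit_vec_mult:
  fixes x :: "'j \<Rightarrow> real"
  assumes "finite J" "j \<in> J"
  shows "(\<Sum>k\<in>J. (if j = k then 1 else 0) * x k) = x j"
    and "(\<Sum>k\<in>J. x k * (if j = k then 1 else 0)) = x j"
    and "(\<Sum>k\<in>J. (if k = j then 1 else 0) * x k) = x j"
    and "(\<Sum>k\<in>J. x k * (if k = j then 1 else 0)) = x j"
  using assms by (auto simp: if_distrib[of "\<lambda>c. c * _"] if_distrib[of "\<lambda>c. _ * c"] cong: if_cong)

text \<open>Induction on the number of inequalities. If the implication survives without row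
  \<open>s\<close>, that row gets multiplier 0. Otherwise a point \<open>x0\<close> violates the
  shortened implication, and projecting along \<open>x0\<close> onto the kernel of row
  \<open>s\<close> eliminates this row.\<close>

lemma farkas:
  fixes a :: "'i \<Rightarrow> 'j \<Rightarrow> real" and g :: "'j \<Rightarrow> real"
  assumes "finite S"
    and "\<And>x. (\<And>i. i \<in> S \<Longrightarrow> (\<Sum>j\<in>J. a i j * x j) \<le> 0) \<Longrightarrow> (\<Sum>j\<in>J. g j * x j) \<le> 0"
    and "finite J"
  shows "\<exists>u. (\<forall>i\<in>S. 0 \<le> u i) \<and> (\<forall>j\<in>J. g j = (\<Sum>i\<in>S. u i * a i j))"
  using assms(1,2)
proof (induction S arbitrary: a g rule: finite_induct)
  case empty
  have "(\<Sum>j\<in>J. g j * g j) \<le> 0" using empty by simp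
  then have "(\<Sum>j\<in>J. g j * g j) = 0" by (simp add: antisym sum_nonneg)
  then have "\<forall>j\<in>J. g j = 0" using \<open>finite J\<close> by (subst (asm) sum_nonneg_eq_0_iff) auto
  then show ?case by simp
next
  case (insert s S)
  show ?case
  proof (cases "\<forall>x. (\<forall>i\<in>S. (\<Sum>j\<in>J. a i j * x j) \<le> 0) \<longrightarrow> (\<Sum>j\<in>J. g j * x j) \<le> 0")
    case True
    then obtain u where u: "\<forall>i\<in>S. 0 \<le> u i" "\<forall>j\<in>J. g j = (\<Sum>i\<in>S. u i * a i j)"
      using insert.IH[of a g] by blast
    have "(\<Sum>i\<in>insert s S. (u(s := 0)) i * a i j) = (\<Sum>i\<in>S. u i * a i j)" for j
      using insert.hyps by (simp, intro sum.cong) auto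
    with u show ?thesis by (intro exI[of _ "u(s := 0)"]) auto
  next
    case False
    then obtain x0 where x0: "\<And>i. i \<in> S \<Longrightarrow> (\<Sum>j\<in>J. a i j * x0 j) \<le> 0" "0 < (\<Sum>j\<in>J. g j * x0 j)"
      by (auto simp: not_le)
    define q where "q = (\<Sum>j\<in>J. a s j * x0 j)"
    have q: "0 < q"
      using insert.prems[of x0] x0 unfolding q_def by (force simp: not_le[symmetric])
    define p where "p h = (\<Sum>j\<in>J. h j * x0 j) / q" for h :: "'j \<Rightarrow> real"
    \<comment> \<open>\<open>P h\<close> is the functional \<open>h\<close> composed with the
      projection along \<open>x0\<close> onto the hyperplane where row \<open>s\<close> vanishes;
      \<open>p h\<close> is the multiple of row \<open>s\<close> that this removes.\<close>
    define P where "P h = (\<lambda>j. h j - p h * a s j)" for h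
    have P: "(\<Sum>j\<in>J. P h j * x j) = (\<Sum>j\<in>J. h j * (x j - (\<Sum>j\<in>J. a s j * x j) / q * x0 j))" for h x
    proof -
      have "(\<Sum>j\<in>J. P h j * x j) = (\<Sum>j\<in>J. h j * x j) - p h * (\<Sum>j\<in>J. a s j * x j)"
        by (simp add: P_def left_diff_distrib sum_subtractf sum_distrib_left mult.assoc)
      also have "p h * t = (\<Sum>j\<in>J. h j * (t / q * x0 j))" for t
        by (simp add: p_def sum_distrib_left sum_divide_distrib mult_ac)
      finally show ?thesis by (simp add: right_diff_distrib sum_subtractf)
    qed
    have "(\<Sum>j\<in>J. P g j * x j) \<le> 0" if x: "\<And>i. i \<in> S \<Longrightarrow> (\<Sum>j\<in>J. P (a i) j * x j) \<le> 0" for x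
    proof -
      have "(\<Sum>j\<in>J. P (a s) j * x j) = 0" using q by (simp add: P_def p_def flip: q_def)
      with x show ?thesis unfolding P by (intro insert.prems) auto
    qed
    then obtain u where u: "\<forall>i\<in>S. 0 \<le> u i" "\<forall>j\<in>J. P g j = (\<Sum>i\<in>S. u i * P (a i) j)"
      using insert.IH[of "\<lambda>i. P (a i)" "P g"] by blast
    \<comment> \<open>The coefficient of row \<open>s\<close> left over when the projections are
      undone. It is nonnegative because \<open>g\<close> is positive at \<open>x0\<close> while the
      rows in \<open>S\<close> are not.\<close>
    define w where "w = p g - (\<Sum>i\<in>S. u i * p (a i))"
    have "(\<Sum>i\<in>S. u i * p (a i)) \<le> 0"
      using u x0 q by (intro sum_nonpos) (auto simp: p_def mult_le_0_iff divide_le_0_iff)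
    moreover have "0 < p g" using x0 q by (simp add: p_def)
    ultimately have "0 \<le> w" by (simp add: w_def)
    have "g j = (\<Sum>i\<in>insert s S. (u(s := w)) i * a i j)" if "j \<in> J" for j
    proof -
      have "g j - p g * a s j = (\<Sum>i\<in>S. u i * a i j) - (\<Sum>i\<in>S. u i * p (a i)) * a s j"
        using u(2) that by (auto simp: P_def right_diff_distrib sum_subtractf sum_distrib_right mult.assoc)
      then have "g j = (\<Sum>i\<in>S. u i * a i j) + w * a s j" by (simp add: w_def algebra_simps)
      also have "(\<Sum>i\<in>S. u i * a i j) = (\<Sum>i\<in>S. (u(s := w)) i * a i j)"
        using insert.hyps by (intro sum.cong) auto
      finally show ?thesis using insert.hyps by simp
    qed
    then show ?thesis using u \<open>0 \<le> w\<close> by (intro exI[of _ "u(s := w)"]) auto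
  qed
qed

text \<open>An equality is a pair of opposite inequalities; the difference of their two multipliers
  is a multiplier of free sign.\<close>

lemma farkas_eq:
  fixes a :: "'i \<Rightarrow> 'j \<Rightarrow> real" and e :: "'k \<Rightarrow> 'j \<Rightarrow> real" and g :: "'j \<Rightarrow> real"
  assumes fin: "finite S" "finite E" "finite J"
    and imp: "\<And>x. (\<And>i. i \<in> E \<Longrightarrow> (\<Sum>j\<in>J. e i j * x j) = 0) \<Longrightarrow>
      (\<And>i. i \<in> S \<Longrightarrow> (\<Sum>j\<in>J. a i j * x j) \<le> 0) \<Longrightarrow> (\<Sum>j\<in>J. g j * x j) \<le> 0"
  shows "\<exists>u v. (\<forall>i\<in>S. 0 \<le> u i) \<and> (\<forall>j\<in>J. g j = (\<Sum>i\<in>E. v i * e i j) + (\<Sum>i\<in>S. u i * a i j))"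
proof -
  define h where "h = case_sum (case_sum e (\<lambda>i j. - e i j)) a"
  have "\<exists>u. (\<forall>i\<in>(E <+> E) <+> S. 0 \<le> u i) \<and> (\<forall>j\<in>J. g j = (\<Sum>i\<in>(E <+> E) <+> S. u i * h i j))"
  proof (rule farkas)
    fix x assume x: "\<And>i. i \<in> (E <+> E) <+> S \<Longrightarrow> (\<Sum>j\<in>J. h i j * x j) \<le> 0"
    have "(\<Sum>j\<in>J. e i j * x j) = 0" if "i \<in> E" for i
      using x[of "Inl (Inl i)"] x[of "Inl (Inr i)"] that by (simp add: h_def InlI InrI sum_negf)
    moreover have "(\<Sum>j\<in>J. a i j * x j) \<le> 0" if "i \<in> S" for i
      using x[of "Inr i"] that by (simp add: h_def InrI)
    ultimately show "(\<Sum>j\<in>J. g j * x j) \<le> 0" by (rule imp)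
  qed (use fin in auto)
  then obtain u where u: "\<forall>i\<in>(E <+> E) <+> S. 0 \<le> u i"
    "\<forall>j\<in>J. g j = (\<Sum>i\<in>(E <+> E) <+> S. u i * h i j)" by blast
  show ?thesis
  proof (intro exI conjI ballI)
    show "0 \<le> u (Inr i)" if "i \<in> S" for i using u that by auto
    show "g j = (\<Sum>i\<in>E. (u (Inl (Inl i)) - u (Inl (Inr i))) * e i j) + (\<Sum>i\<in>S. u (Inr i) * a i j)"
      if "j \<in> J" for j
      using u(2) that fin by (simp add: sum.Plus h_def left_diff_distrib sum_subtractf sum_negf)
  qed
qed

text \<open>The case of \<open>farkas_eq\<close> without inequality rows. It takes the place of rank
  and dimension arguments below.\<close>

lemma in_span_if_kernel:
  fixes e :: "'k \<Rightarrow> 'j \<Rightarrow> real" and g :: "'j \<Rightarrow> real"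
  assumes "finite E" "finite J"
    and "\<And>x. (\<And>i. i \<in> E \<Longrightarrow> (\<Sum>j\<in>J. e i j * x j) = 0) \<Longrightarrow> (\<Sum>j\<in>J. g j * x j) = 0"
  shows "\<exists>v. \<forall>j\<in>J. g j = (\<Sum>i\<in>E. v i * e i j)"
  using farkas_eq[of "{}::unit set" E J e "\<lambda>_ _. 0" g] assms by force

text \<open>Trivial kernels of the matrix and of its transpose put all unit vectors into the row
  space and the column space, which yields a left inverse \<open>C\<close> and a right inverse
  \<open>D\<close>. These agree by associativity. That the matrix is square is part of the
  conclusion.\<close>

lemma two_sided_inverse_if_injective:
  fixes a :: "'i \<Rightarrow> 'j \<Rightarrow> real"
  assumes fin: "finite R" "finite J"
    and cols: "\<And>z. (\<And>i. i \<in> R \<Longrightarrow> (\<Sum>j\<in>J. a i j * z j) = 0) \<Longrightarrow> \<forall>j\<in>J. z j = 0"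
    and rows: "\<And>y. (\<And>j. j \<in> J \<Longrightarrow> (\<Sum>i\<in>R. a i j * y i) = 0) \<Longrightarrow> \<forall>i\<in>R. y i = 0"
  obtains C where "\<And>j k. j \<in> J \<Longrightarrow> k \<in> J \<Longrightarrow> (\<Sum>i\<in>R. C j i * a i k) = (if j = k then 1 else 0)"
    "\<And>i l. i \<in> R \<Longrightarrow> l \<in> R \<Longrightarrow> (\<Sum>j\<in>J. a i j * C j l) = (if i = l then 1 else 0)"
    "card J = card R"
proof -
  have "\<exists>v. \<forall>k\<in>J. (if j = k then 1 else 0) = (\<Sum>i\<in>R. v i * a i k)" if "j \<in> J" for j
    using fin cols that by (intro in_span_if_kernel) (auto simp: sum_unit_vec_mult)
  then obtain C where C: "\<And>j k. j \<in> J \<Longrightarrow> k \<in> J \<Longrightarrow> (\<Sum>i\<in>R. C j i * a i k) = (if j = k then 1 else 0)"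
    by metis
  have "\<exists>v. \<forall>l\<in>R. (if i = l then 1 else 0) = (\<Sum>j\<in>J. v j * a l j)" if "i \<in> R" for i
    using fin rows that by (intro in_span_if_kernel) (auto simp: sum_unit_vec_mult)
  then obtain D where D: "\<And>i l. i \<in> R \<Longrightarrow> l \<in> R \<Longrightarrow> (\<Sum>j\<in>J. D i j * a l j) = (if i = l then 1 else 0)"
    by metis
  have CD: "C j l = D l j" if "j \<in> J" "l \<in> R" for j l
  proof -
    have "C j l = (\<Sum>i\<in>R. C j i * (\<Sum>k\<in>J. D l k * a i k))"
      using that fin by (simp add: D sum_unit_vec_mult cong: sum.cong)
    also have "\<dots> = (\<Sum>k\<in>J. (\<Sum>i\<in>R. C j i * a i k) * D l k)"
      unfolding sum_distrib_left sum_distrib_right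
      by (subst sum.swap) (simp add: mult_ac)
    also have "\<dots> = D l j"
      using that fin by (simp add: C sum_unit_vec_mult cong: sum.cong)
    finally show ?thesis .
  qed
  have right: "(\<Sum>j\<in>J. a i j * C j l) = (if i = l then 1 else 0)" if "i \<in> R" "l \<in> R" for i l
    using D[OF that(2,1)] that by (simp add: CD mult.commute eq_commute cong: sum.cong)
  \<comment> \<open>Both products of the two one-sided inverses have the same trace.\<close>
  have "real (card J) = (\<Sum>j\<in>J. \<Sum>i\<in>R. C j i * a i j)" by (simp add: C)
  also have "\<dots> = (\<Sum>i\<in>R. \<Sum>j\<in>J. a i j * C j i)" by (subst sum.swap) (simp add: mult.commute)
  also have "\<dots> = real (card R)" by (simp add: right)
  finally have "card J = card R" by simp
  with C right show ?thesis by (rule that)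
qed

section \<open>Basic solutions and weak duality\<close>

lemma bij_betw_idx:
  assumes "finite I"
  shows "bij_betw (idx I) {..<card I} I"
  unfolding idx_def
  by (rule bij_betw_nth) (use assms in auto)

text \<open>Reconciles the two descriptions of position: \<open>xsol\<close> finds the row of a
  coordinate by counting smaller members of the basis, whereas \<open>colsub\<close> and the cones
  enumerate the basis through \<open>idx\<close>.\<close>

lemma card_less_idx:
  assumes "finite I" "j < card I"
  shows "card {i\<in>I. i < idx I j} = j"
proof -
  have mono: "idx I k < idx I l" if "k < l" "l < card I" for k l
    using sorted_wrt_nth_less[OF strict_sorted_list_of_set, of k l I] that assms by (simp add: idx_def)
  have iff: "idx I k < idx I j \<longleftrightarrow> k < j" if "k < card I" for k
    using mono[of k j] mono[of j k] that assms by (metis less_irrefl linorder_neqE_nat order_less_trans)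
  have "{i\<in>I. i < idx I j} = idx I ` {..<j}"
  proof (intro equalityI subsetI)
    fix i assume "i \<in> {i\<in>I. i < idx I j}"
    moreover from this obtain k where "k < card I" "i = idx I k"
      using bij_betw_imp_surj_on[OF bij_betw_idx[OF assms(1)]] by blast
    ultimately show "i \<in> idx I ` {..<j}" using iff by blast
  next
    fix i assume "i \<in> idx I ` {..<j}"
    then obtain k where "k < j" "i = idx I k" by blast
    then show "i \<in> {i\<in>I. i < idx I j}"
      using iff bij_betwE[OF bij_betw_idx[OF assms(1)]] assms(2) by simp
  qed
  moreover have "inj_on (idx I) {..<j}"
    by (rule inj_on_subset[OF bij_betw_imp_inj_on[OF bij_betw_idx[OF assms(1)]]]) (use assms(2) in auto)
  ultimately show ?thesis by (simp add: card_image)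
qed

lemma colsub_apply: "colsub A I i j = A i (idx I j)"
  by (simp add: colsub_def)

lemma is_basis_finite: "is_basis A m d I \<Longrightarrow> finite I"
  unfolding is_basis_def by (meson finite_lessThan finite_subset)

lemma is_basis_bij: "is_basis A m d I \<Longrightarrow> bij_betw (idx I) {..<m} I"
  using bij_betw_idx[of I] is_basis_finite[of A m d I] by (simp add: is_basis_def)

lemma is_basis_idx_mem: "is_basis A m d I \<Longrightarrow> j < m \<Longrightarrow> idx I j \<in> I"
  by (meson bij_betwE is_basis_bij lessThan_iff)

lemma is_basis_inverse:
  "is_basis A m d I \<Longrightarrow> is_inverse m (colsub A I) (inv_sq m (colsub A I))"
  unfolding is_basis_def invertible_sq_def inv_sq_def by (metis someI_ex)

lemma is_basis_sum:
  "is_basis A m d I \<Longrightarrow> (\<Sum>j\<in>I. f j) = (\<Sum>l<m. f (idx I l))"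
  by (rule sum.reindex_bij_betw[symmetric]) (rule is_basis_bij)

lemma is_basis_sum_supported:
  assumes "is_basis A m d I" "\<And>j. j \<notin> I \<Longrightarrow> f j = 0"
  shows "(\<Sum>j<d. f j) = (\<Sum>l<m. f (idx I l))"
proof -
  have "(\<Sum>j<d. f j) = (\<Sum>j\<in>I. f j)"
    using assms by (intro sum.mono_neutral_right) (auto simp: is_basis_def)
  then show ?thesis by (simp add: is_basis_sum[OF assms(1)])
qed

lemma xsol_notin: "i \<notin> I \<Longrightarrow> xsol A m I v i = 0"
  by (simp add: xsol_def)

lemma xsol_idx:
  "is_basis A m d I \<Longrightarrow> j < m \<Longrightarrow> xsol A m I v (idx I j) = (\<Sum>l<m. inv_sq m (colsub A I) j l * v l)"
  using card_less_idx[of I j] is_basis_idx_mem[of A m d I j] is_basis_finite[of A m d I]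
  by (simp add: xsol_def is_basis_def)

lemma xsol_solves:
  assumes I: "is_basis A m d I" and i: "i < m"
  shows "(\<Sum>j<d. A i j * xsol A m I v j) = v i"
proof -
  let ?B = "colsub A I" let ?C = "inv_sq m ?B"
  have inv: "(\<Sum>p<m. ?B i p * ?C p l) = (if i = l then 1 else 0)" if "l < m" for l
    using is_basis_inverse[OF I] i that by (simp add: is_inverse_def)
  have "(\<Sum>j<d. A i j * xsol A m I v j) = (\<Sum>p<m. A i (idx I p) * xsol A m I v (idx I p))"
    by (rule is_basis_sum_supported[OF I]) (simp add: xsol_notin)
  also have "\<dots> = (\<Sum>p<m. \<Sum>l<m. ?B i p * ?C p l * v l)"
    by (simp add: xsol_idx[OF I] sum_distrib_left colsub_apply mult.assoc cong: sum.cong_simp)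
  also have "\<dots> = (\<Sum>l<m. (\<Sum>p<m. ?B i p * ?C p l) * v l)"
    by (subst sum.swap) (simp add: sum_distrib_right)
  also have "\<dots> = v i" using i by (simp add: inv sum_unit_vec_mult cong: sum.cong_simp)
  finally show ?thesis .
qed

lemma xsol_unique:
  assumes I: "is_basis A m d I" and x: "\<And>j. j \<notin> I \<Longrightarrow> x j = 0"
    and sol: "\<And>i. i < m \<Longrightarrow> (\<Sum>j<d. A i j * x j) = v i"
  shows "xsol A m I v = x"
proof
  fix j
  let ?B = "colsub A I" let ?C = "inv_sq m ?B"
  show "xsol A m I v j = x j"
  proof (cases "j \<in> I")
    case True
    then obtain q where q: "q < m" "j = idx I q"
      using is_basis_bij[OF I] unfolding bij_betw_def by auto
    have inv: "(\<Sum>l<m. ?C q l * ?B l p) = (if q = p then 1 else 0)" if "p < m" for p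
      using is_basis_inverse[OF I] q that by (simp add: is_inverse_def)
    have v: "v l = (\<Sum>p<m. ?B l p * x (idx I p))" if "l < m" for l
      unfolding sol[OF that, symmetric] colsub_apply
      by (rule is_basis_sum_supported[OF I]) (simp add: x)
    have "xsol A m I v j = (\<Sum>l<m. \<Sum>p<m. ?C q l * ?B l p * x (idx I p))"
      using q by (simp add: xsol_idx[OF I] v sum_distrib_left mult.assoc cong: sum.cong_simp)
    also have "\<dots> = (\<Sum>p<m. (\<Sum>l<m. ?C q l * ?B l p) * x (idx I p))"
      by (subst sum.swap) (simp add: sum_distrib_right)
    also have "\<dots> = x j" using q by (simp add: inv sum_unit_vec_mult cong: sum.cong_simp)
    finally show ?thesis .
  qed (simp add: x xsol_notin)
qed

lemma dual_sol_active:
  assumes I: "is_basis A m d I" and j: "j \<in> I"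
  shows "(\<Sum>i<m. A i j * dual_sol A c m I i) = c j"
proof -
  let ?B = "colsub A I" let ?C = "inv_sq m ?B"
  obtain q where q: "q < m" "j = idx I q"
    using is_basis_bij[OF I] j unfolding bij_betw_def by auto
  have inv: "(\<Sum>i<m. ?C l i * ?B i q) = (if l = q then 1 else 0)" if "l < m" for l
    using is_basis_inverse[OF I] q that by (simp add: is_inverse_def)
  have "(\<Sum>i<m. A i j * dual_sol A c m I i) = (\<Sum>i<m. \<Sum>l<m. ?C l i * ?B i q * c (idx I l))"
    using q by (simp add: dual_sol_def sum_distrib_left colsub_apply mult_ac cong: sum.cong_simp)
  also have "\<dots> = (\<Sum>l<m. (\<Sum>i<m. ?C l i * ?B i q) * c (idx I l))"
    by (subst sum.swap) (simp add: sum_distrib_right)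
  also have "\<dots> = c j" using q by (simp add: inv sum_unit_vec_mult cong: sum.cong_simp)
  finally show ?thesis .
qed

lemma dual_sol_unique:
  assumes I: "is_basis A m d I" and y: "\<And>j. j \<in> I \<Longrightarrow> (\<Sum>i<m. A i j * y i) = c j"
    and i: "i < m"
  shows "dual_sol A c m I i = y i"
proof -
  let ?B = "colsub A I" let ?C = "inv_sq m ?B"
  have inv: "(\<Sum>l<m. ?B k l * ?C l i) = (if k = i then 1 else 0)" if "k < m" for k
    using is_basis_inverse[OF I] i that by (simp add: is_inverse_def)
  have "dual_sol A c m I i = (\<Sum>l<m. \<Sum>k<m. ?B k l * ?C l i * y k)"
    using i by (simp add: dual_sol_def y[symmetric] is_basis_idx_mem[OF I] sum_distrib_left
        colsub_apply mult_ac cong: sum.cong_simp)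
  also have "\<dots> = (\<Sum>k<m. (\<Sum>l<m. ?B k l * ?C l i) * y k)"
    by (subst sum.swap) (simp add: sum_distrib_right)
  also have "\<dots> = y i" using i by (simp add: inv sum_unit_vec_mult cong: sum.cong_simp)
  finally show ?thesis .
qed

text \<open>The primal point vanishes off \<open>I\<close> and the dual point is tight on
  \<open>I\<close>, so the two objective values coincide; weak duality makes this common value a
  lower bound for every feasible cost.\<close>

lemma dual_feasible_basis_optimal:
  assumes I: "dual_feasible_basis A c m d I" and nn: "nonneg_vec d (xsol A m I \<beta>)"
  shows "lp_optimal A c m d \<beta> (xsol A m I \<beta>)"
proof -
  have basis: "is_basis A m d I" using I by (simp add: dual_feasible_basis_def)
  let ?l = "dual_sol A c m I" let ?x = "xsol A m I \<beta>"
  have feas: "lp_feasible A m d \<beta> ?x"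
    using basis nn by (auto simp: lp_feasible_def nonneg_vec_def xsol_solves vecs_def is_basis_def
        intro!: xsol_notin)
  have swap: "(\<Sum>j<d. (\<Sum>i<m. A i j * ?l i) * y j) = (\<Sum>i<m. \<beta> i * ?l i)"
    if "lp_feasible A m d \<beta> y" for y
  proof -
    have "(\<Sum>j<d. (\<Sum>i<m. A i j * ?l i) * y j) = (\<Sum>i<m. (\<Sum>j<d. A i j * y j) * ?l i)"
      unfolding sum_distrib_right by (subst sum.swap) (simp add: mult_ac)
    then show ?thesis using that by (simp add: lp_feasible_def)
  qed
  have "(\<Sum>j<d. c j * ?x j) \<le> (\<Sum>j<d. c j * y j)" if y: "lp_feasible A m d \<beta> y" for y
  proof -
    have "c j * ?x j = (\<Sum>i<m. A i j * ?l i) * ?x j" for j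
      by (cases "j \<in> I") (simp_all add: dual_sol_active[OF basis] xsol_notin)
    then have "(\<Sum>j<d. c j * ?x j) = (\<Sum>j<d. (\<Sum>i<m. A i j * ?l i) * y j)"
      unfolding swap[OF y] swap[OF feas, symmetric] by (intro sum.cong) auto
    also have "\<dots> \<le> (\<Sum>j<d. c j * y j)"
      using I y by (intro sum_mono mult_right_mono) (auto simp: dual_feasible_basis_def lp_feasible_def)
    finally show ?thesis .
  qed
  with feas show ?thesis by (simp add: lp_optimal_def)
qed

section \<open>Ratio test and complementary slackness\<close>

text \<open>The longest step in direction \<open>q\<close> that the slacks \<open>s\<close> allow,
  together with a blocking index \<open>l\<close>. It is used on the dual side to gain an active
  constraint and on the primal side to lose a support index.\<close>

lemma ratio_test:
  fixes s q :: "nat \<Rightarrow> real"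
  assumes "finite J" "k \<in> J" "0 < q k" "\<And>j. j \<in> J \<Longrightarrow> 0 \<le> s j"
  obtains t l where "0 \<le> t" "l \<in> J" "0 < q l" "s l = t * q l" "\<And>j. j \<in> J \<Longrightarrow> t * q j \<le> s j"
proof -
  define P where "P = {j\<in>J. 0 < q j}"
  have P: "finite P" "P \<noteq> {}" using assms by (auto simp: P_def)
  define l where "l = arg_min_on (\<lambda>j. s j / q j) P"
  have l: "l \<in> P" using P unfolding l_def by (rule arg_min_if_finite)
  have min: "s l / q l \<le> s j / q j" if "j \<in> P" for j
    unfolding l_def by (rule arg_min_least) (use P that in auto)
  have "0 \<le> s l / q l" using l assms(4)[of l] by (auto simp: P_def)
  moreover have "s l / q l * q j \<le> s j" if j: "j \<in> J" for j
  proof (cases "0 < q j")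
    case True
    with min[of j] j show ?thesis by (simp add: P_def pos_le_divide_eq)
  next
    case False
    then have "s l / q l * q j \<le> 0" using \<open>0 \<le> s l / q l\<close> by (intro mult_nonneg_nonpos) auto
    with assms(4)[OF j] show ?thesis by linarith
  qed
  ultimately show ?thesis using l by (intro that[of "s l / q l" l]) (auto simp: P_def)
qed

text \<open>The directions \<open>z\<close> with A z = 0 and z \<ge> 0 on the zero set
  \<open>Z\<close> of \<open>x\<close> keep \<open>x\<close> feasible for a short step, so
  optimality gives c z \<ge> 0 on them. Farkas applied to -c yields the dual point
  \<open>- v\<close>; the reduced costs \<open>u\<close> live on \<open>Z\<close> only, hence
  tightness wherever \<open>x\<close> is nonzero.\<close>

lemma lp_complementary_slackness:
  assumes opt: "lp_optimal A c m d \<beta> x"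
  obtains y where "\<And>j. j < d \<Longrightarrow> (\<Sum>i<m. A i j * y i) \<le> c j"
    "\<And>j. j < d \<Longrightarrow> x j \<noteq> 0 \<Longrightarrow> (\<Sum>i<m. A i j * y i) = c j"
proof -
  define Z where "Z = {j. j < d \<and> x j = 0}"
  have feas: "x \<in> vecs d" "\<And>j. j < d \<Longrightarrow> 0 \<le> x j" "\<And>i. i < m \<Longrightarrow> (\<Sum>j<d. A i j * x j) = \<beta> i"
    using opt by (auto simp: lp_optimal_def lp_feasible_def)
  have "\<exists>u v. (\<forall>k\<in>Z. 0 \<le> u k) \<and> (\<forall>j\<in>{..<d}. - c j =
      (\<Sum>i\<in>{..<m}. v i * A i j) + (\<Sum>k\<in>Z. u k * (if k = j then -1 else 0)))"
  proof (rule farkas_eq)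
    fix z assume Az: "\<And>i. i \<in> {..<m} \<Longrightarrow> (\<Sum>j\<in>{..<d}. A i j * z j) = 0"
      and z: "\<And>k. k \<in> Z \<Longrightarrow> (\<Sum>j\<in>{..<d}. (if k = j then -1 else 0) * z j) \<le> 0"
    have zZ: "0 \<le> z k" if "k \<in> Z" for k
    proof -
      have "(\<Sum>j<d. (if k = j then -1 else 0) * z j) = - z k"
        using that by (simp add: Z_def if_distrib[of "\<lambda>c. c * _"] cong: if_cong)
      with z[OF that] show ?thesis by simp
    qed
    \<comment> \<open>A step short enough for every nonzero coordinate to stay nonnegative. The
      summand 1 in the denominator avoids division by zero, and the inserted 1 keeps the set
      nonempty.\<close>
    define t where "t = Min (insert 1 ((\<lambda>j. x j / (\<bar>z j\<bar> + 1)) ` ({..<d} - Z)))"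
    have t: "0 < t" "\<And>j. j < d \<Longrightarrow> j \<notin> Z \<Longrightarrow> t \<le> x j / (\<bar>z j\<bar> + 1)"
      using feas(2) unfolding t_def
      by (subst Min_gr_iff) (auto simp: Z_def less_le intro!: divide_pos_pos)
    define w where "w = (\<lambda>j. if j < d then x j + t * z j else 0)"
    have w: "0 \<le> w j" if "j < d" for j
    proof (cases "j \<in> Z")
      case True
      then show ?thesis using zZ t(1) that by (simp add: w_def Z_def)
    next
      case False
      have "t * \<bar>z j\<bar> \<le> t * (\<bar>z j\<bar> + 1)" using t(1) by simp
      also have "\<dots> \<le> x j" using t(2)[OF that False] by (simp add: pos_le_divide_eq)
      finally have "- (t * z j) \<le> x j" using abs_ge_minus_self[of "t * z j"] t(1) by (simp add: abs_mult)
      then show ?thesis using that by (simp add: w_def)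
    qed
    have ws: "(\<Sum>j<d. f j * w j) = (\<Sum>j<d. f j * x j) + t * (\<Sum>j<d. f j * z j)" for f :: "nat \<Rightarrow> real"
      by (simp add: w_def algebra_simps sum.distrib sum_distrib_left)
    have "lp_feasible A m d \<beta> w"
      unfolding lp_feasible_def ws using w Az feas(3) by (simp add: vecs_def) (simp add: w_def)
    then have "(\<Sum>j<d. c j * x j) \<le> (\<Sum>j<d. c j * w j)" using opt by (simp add: lp_optimal_def)
    then have "0 \<le> t * (\<Sum>j<d. c j * z j)" by (simp add: ws)
    then show "(\<Sum>j\<in>{..<d}. - c j * z j) \<le> 0"
      using t(1) by (simp add: zero_le_mult_iff sum_negf)
  qed (auto simp: Z_def)
  then obtain u v where u: "\<forall>k\<in>Z. 0 \<le> u k" and v: "\<And>j. j < d \<Longrightarrow> - c j =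
      (\<Sum>i<m. v i * A i j) + (\<Sum>k\<in>Z. u k * (if k = j then -1 else 0))" by auto
  have "(\<Sum>k\<in>Z. u k * (if k = j then -1 else 0)) = (if j \<in> Z then - u j else 0)" for j
    by (simp add: if_distrib[of "\<lambda>c. _ * c"] Z_def cong: if_cong)
  with v have "(\<Sum>i<m. A i j * - v i) = c j + (if j \<in> Z then - u j else 0)" if "j < d" for j
    using that by (fastforce simp: sum_negf mult.commute)
  then show ?thesis using u by (intro that[of "\<lambda>i. - v i"]) (auto simp: Z_def)
qed

section \<open>Existence of an optimal basis\<close>

text \<open>Take a dual feasible point with as many active constraints as possible among those
  active on \<open>S\<close>. If the active columns did not span, some direction \<open>z\<close>
  would be orthogonal to all of them; by full rank it changes another constraint, and moving up to
  the first one that blocks would add an active constraint.\<close>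

lemma exists_spanning_active_set:
  assumes rank: "full_row_rank A m d"
    and y0: "\<And>j. j < d \<Longrightarrow> (\<Sum>i<m. A i j * y0 i) \<le> c j" "\<And>j. j \<in> S \<Longrightarrow> (\<Sum>i<m. A i j * y0 i) = c j"
    and S: "S \<subseteq> {..<d}"
  obtains y where "\<And>j. j < d \<Longrightarrow> (\<Sum>i<m. A i j * y i) \<le> c j"
    "S \<subseteq> {j. j < d \<and> (\<Sum>i<m. A i j * y i) = c j}"
    "\<And>z. (\<And>j. j < d \<Longrightarrow> (\<Sum>i<m. A i j * y i) = c j \<Longrightarrow> (\<Sum>i<m. A i j * z i) = 0) \<Longrightarrow> \<forall>i<m. z i = 0"
proof -
  define act where "act y = {j. j < d \<and> (\<Sum>i<m. A i j * y i) = c j}" for y :: "nat \<Rightarrow> real"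
  define good where "good y \<longleftrightarrow> (\<forall>j<d. (\<Sum>i<m. A i j * y i) \<le> c j) \<and> S \<subseteq> act y" for y :: "nat \<Rightarrow> real"
  have fin: "finite (act y)" for y by (simp add: act_def)
  have "card (act y) \<le> d" for y
    using card_mono[of "{..<d}" "act y"] by (auto simp: act_def)
  moreover have "good y0" using y0 S by (auto simp: good_def act_def)
  ultimately obtain y where y: "good y" and max: "\<And>w. good w \<Longrightarrow> card (act w) \<le> card (act y)"
    using ex_has_greatest_nat[of good y0 "\<lambda>y. card (act y)" "Suc d"] by (auto simp: less_Suc_eq_le)
  have False if z: "\<And>j. j \<in> act y \<Longrightarrow> (\<Sum>i<m. A i j * z i) = 0" and "i0 < m" "z i0 \<noteq> 0" for z i0
  proof -
    let ?z = "\<lambda>i. if i < m then z i else 0"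
    have zv: "?z \<in> vecs m" and zn: "?z \<noteq> (\<lambda>_. 0)" using that by (auto simp: vecs_def fun_eq_iff)
    have "\<not> (\<forall>j<d. (\<Sum>i<m. ?z i * A i j) = 0)"
      by (rule contrapos_nn[OF zn]) (rule mp[OF bspec[OF rank[unfolded full_row_rank_def] zv]])
    then obtain k where k: "k < d" "(\<Sum>i<m. ?z i * A i k) \<noteq> 0" by blast
    \<comment> \<open>The sign makes the left side of constraint \<open>k\<close> grow along the
      motion, so that some constraint must block. Active constraints have \<open>q\<close> equal to
      0 and stay tight.\<close>
    define \<sigma> where "\<sigma> = sgn (\<Sum>i<m. A i k * z i)"
    define q where "q j = \<sigma> * (\<Sum>i<m. A i j * z i)" for j
    have "(\<Sum>i<m. A i k * z i) \<noteq> 0" using k(2) by (simp add: mult.commute cong: sum.cong_simp)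
    then have qk: "0 < q k" by (simp add: q_def \<sigma>_def sgn_if)
    obtain t l where t: "0 \<le> t" "l < d" "0 < q l" "c l - (\<Sum>i<m. A i l * y i) = t * q l"
      "\<And>j. j < d \<Longrightarrow> t * q j \<le> c j - (\<Sum>i<m. A i j * y i)"
      by (rule ratio_test[of "{..<d}" k q "\<lambda>j. c j - (\<Sum>i<m. A i j * y i)"])
        (use k(1) qk y in \<open>auto simp: good_def\<close>)
    define w where "w = (\<lambda>i. y i + t * \<sigma> * z i)"
    have w: "(\<Sum>i<m. A i j * w i) = (\<Sum>i<m. A i j * y i) + t * q j" for j
      by (simp add: w_def q_def algebra_simps sum.distrib sum_distrib_left)
    have sub: "act y \<subseteq> act w" using z by (auto simp: act_def w q_def)
    have "l \<in> act w" "l \<notin> act y" using t(2-4) z by (auto simp: act_def w q_def)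
    then have "card (act y) < card (act w)" using sub fin by (intro psubset_card_mono) auto
    moreover have "good w" using t(5)[unfolded le_diff_eq] y sub by (auto simp: good_def w add.commute)
    ultimately show False using max by fastforce
  qed
  then show ?thesis using y by (intro that[of y]) (auto simp: good_def act_def)
qed

definition lin_indep_cols :: "(nat \<Rightarrow> nat \<Rightarrow> real) \<Rightarrow> nat \<Rightarrow> nat set \<Rightarrow> bool" where
  "lin_indep_cols A m I \<longleftrightarrow>
     (\<forall>z. (\<forall>i<m. (\<Sum>j\<in>I. A i j * z j) = 0) \<longrightarrow> (\<forall>j\<in>I. z j = 0))"

text \<open>A support of least size works: a dependence among its columns is a direction that
  preserves A x, and following it until a coordinate reaches 0 would shrink the support. The cost is
  not tracked, because inclusion of supports already preserves complementary slackness with a fixed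
  dual point.\<close>

lemma exists_independent_support:
  assumes feas: "lp_feasible A m d \<beta> x0"
  obtains x where "lp_feasible A m d \<beta> x" "{j. x j \<noteq> 0} \<subseteq> {j. x0 j \<noteq> 0}"
    "lin_indep_cols A m {j. x j \<noteq> 0}"
proof -
  define good where "good x \<longleftrightarrow> lp_feasible A m d \<beta> x \<and> {j. x j \<noteq> 0} \<subseteq> {j. x0 j \<noteq> 0}" for x
  have "good x0" using feas by (simp add: good_def)
  then obtain x where x: "good x" and min: "\<And>w. good w \<Longrightarrow> card {j. x j \<noteq> 0} \<le> card {j. w j \<noteq> 0}"
    using ex_has_least_nat[of good x0 "\<lambda>x. card {j. x j \<noteq> 0}"] by blast
  have sub: "{j. x j \<noteq> 0} \<subseteq> {..<d}"
    using x by (auto simp: good_def lp_feasible_def vecs_def not_less[symmetric])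
  then have fin: "finite {j. x j \<noteq> 0}" by (rule finite_subset) simp
  have "lin_indep_cols A m {j. x j \<noteq> 0}"
    unfolding lin_indep_cols_def
  proof (intro allI impI, rule ccontr)
    fix z assume z: "\<forall>i<m. (\<Sum>j\<in>{j. x j \<noteq> 0}. A i j * z j) = 0"
      and "\<not> (\<forall>j\<in>{j. x j \<noteq> 0}. z j = 0)"
    then obtain k where k: "x k \<noteq> 0" "z k \<noteq> 0" by auto
    \<comment> \<open>The dependence, extended by 0 off the support and signed so that subtracting
      it lowers coordinate \<open>k\<close>; the ratio test needs one positive entry.\<close>
    define q where "q j = (if x j = 0 then 0 else sgn (z k) * z j)" for j
    have qk: "0 < q k" using k by (simp add: q_def sgn_if)
    obtain t l where t: "l \<in> {j. x j \<noteq> 0}" "0 < q l" "x l = t * q l"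
      "\<And>j. j \<in> {j. x j \<noteq> 0} \<Longrightarrow> t * q j \<le> x j"
      by (rule ratio_test[of "{j. x j \<noteq> 0}" k q x])
        (use k(1) qk fin x sub in \<open>auto simp: good_def lp_feasible_def\<close>)
    have Aq: "(\<Sum>j<d. A i j * q j) = 0" if "i < m" for i
    proof -
      have "(\<Sum>j<d. A i j * q j) = (\<Sum>j\<in>{j. x j \<noteq> 0}. A i j * q j)"
        using sub by (intro sum.mono_neutral_right) (auto simp: q_def)
      also have "\<dots> = sgn (z k) * (\<Sum>j\<in>{j. x j \<noteq> 0}. A i j * z j)"
        unfolding sum_distrib_left by (intro sum.cong) (auto simp: q_def)
      finally show ?thesis using z that by simp
    qed
    define w where "w = (\<lambda>j. x j - t * q j)"
    have supp: "{j. w j \<noteq> 0} \<subseteq> {j. x j \<noteq> 0}" by (auto simp: w_def q_def)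
    have "0 \<le> w j" for j using t(4)[of j] by (cases "x j = 0") (auto simp: w_def q_def)
    moreover have "(\<Sum>j<d. A i j * w j) = (\<Sum>j<d. A i j * x j)" if "i < m" for i
    proof -
      have "(\<Sum>j<d. A i j * w j) = (\<Sum>j<d. A i j * x j) - t * (\<Sum>j<d. A i j * q j)"
        by (simp add: w_def algebra_simps sum_subtractf sum_distrib_left)
      then show ?thesis using Aq[OF that] by simp
    qed
    moreover have "w \<in> vecs d" using x by (auto simp: good_def lp_feasible_def vecs_def w_def q_def)
    ultimately have "good w" using x supp by (auto simp: good_def lp_feasible_def)
    moreover have "card {j. w j \<noteq> 0} < card {j. x j \<noteq> 0}"
      using supp t(1,3) by (intro psubset_card_mono fin psubsetI) (auto simp: w_def)
    ultimately show False using min[of w] by simp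
  qed
  with x show ?thesis by (intro that[of x]) (auto simp: good_def)
qed

text \<open>Steinitz extension. For an independent \<open>I\<close> of maximal size between
  \<open>S\<close> and \<open>T\<close>, every column of \<open>T\<close> is a combination of
  columns of \<open>I\<close>, so a vector orthogonal to the columns of \<open>I\<close> is
  orthogonal to those of \<open>T\<close> and vanishes. Both kernels are then trivial, which gives
  the inverse and \<open>card I = m\<close>.\<close>

lemma extend_to_basis:
  assumes S: "lin_indep_cols A m S" "S \<subseteq> T" and T: "T \<subseteq> {..<d}"
    and span: "\<And>z. (\<And>j. j \<in> T \<Longrightarrow> (\<Sum>i<m. A i j * z i) = 0) \<Longrightarrow> \<forall>i<m. z i = 0"
  obtains I where "is_basis A m d I" "S \<subseteq> I" "I \<subseteq> T"
proof -
  define good where "good I \<longleftrightarrow> lin_indep_cols A m I \<and> S \<subseteq> I \<and> I \<subseteq> T" for I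
  have finT: "finite T" using T by (rule finite_subset) simp
  have "card I \<le> card T" if "good I" for I using that finT by (auto simp: good_def intro: card_mono)
  moreover have "good S" using S by (simp add: good_def)
  ultimately obtain I where I: "good I" and max: "\<And>J. good J \<Longrightarrow> card J \<le> card I"
    using ex_has_greatest_nat[of good S card "Suc (card T)"] by (auto simp: less_Suc_eq_le)
  have finI: "finite I" using I finT by (auto simp: good_def intro: finite_subset)
  have spanI: "\<forall>i<m. z i = 0" if z: "\<And>j. j \<in> I \<Longrightarrow> (\<Sum>i<m. A i j * z i) = 0" for z
  proof (rule span)
    fix j assume j: "j \<in> T"
    show "(\<Sum>i<m. A i j * z i) = 0"
    proof (cases "j \<in> I")
      case False
      have "\<not> good (insert j I)" using max[of "insert j I"] finI False by auto
      then obtain w where w: "\<And>i. i < m \<Longrightarrow> (\<Sum>k\<in>insert j I. A i k * w k) = 0"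
        and nz: "\<exists>k\<in>insert j I. w k \<noteq> 0"
        using I j by (auto simp: good_def lin_indep_cols_def)
      then have wj: "A i j * w j + (\<Sum>k\<in>I. A i k * w k) = 0" if "i < m" for i
        using that finI False by auto
      have "w j \<noteq> 0"
      proof
        assume "w j = 0"
        with wj have "\<forall>k\<in>I. w k = 0" using I by (auto simp: good_def lin_indep_cols_def)
        with nz \<open>w j = 0\<close> show False by auto
      qed
      have "w j * (\<Sum>i<m. A i j * z i) = (\<Sum>i<m. (A i j * w j) * z i)"
        by (simp add: sum_distrib_left mult_ac)
      also have "\<dots> = (\<Sum>i<m. - (\<Sum>k\<in>I. A i k * w k) * z i)"
        using wj by (intro sum.cong) (auto simp: add_eq_0_iff2)
      also have "\<dots> = - (\<Sum>k\<in>I. w k * (\<Sum>i<m. A i k * z i))"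
        by (simp add: sum_negf sum_distrib_left sum_distrib_right)
          (subst sum.swap, simp add: mult_ac)
      also have "\<dots> = 0" using z by simp
      finally show ?thesis using \<open>w j \<noteq> 0\<close> by simp
    qed (use z in auto)
  qed
  obtain C where C: "\<And>j k. j \<in> I \<Longrightarrow> k \<in> I \<Longrightarrow> (\<Sum>i<m. C j i * A i k) = (if j = k then 1 else 0)"
    "\<And>i l. i < m \<Longrightarrow> l < m \<Longrightarrow> (\<Sum>j\<in>I. A i j * C j l) = (if i = l then 1 else 0)"
    "card I = m"
  proof (rule two_sided_inverse_if_injective[of "{..<m}" I A])
    show "\<forall>j\<in>I. z j = 0" if "\<And>i. i \<in> {..<m} \<Longrightarrow> (\<Sum>j\<in>I. A i j * z j) = 0" for z
      using that I by (simp add: good_def lin_indep_cols_def)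
  qed (use finI spanI in auto)
  have bij: "bij_betw (idx I) {..<m} I" using bij_betw_idx[OF finI] C(3) by simp
  have eq: "idx I j = idx I k \<longleftrightarrow> j = k" if "j < m" "k < m" for j k
    using bij_betw_imp_inj_on[OF bij] that by (auto dest: inj_onD)
  have mem: "idx I j \<in> I" if "j < m" for j using bij_betwE[OF bij] that by simp
  have "is_inverse m (colsub A I) (\<lambda>l i. C (idx I l) i)"
    unfolding is_inverse_def colsub_apply
  proof (intro conjI allI impI)
    fix i j assume "i < m" "j < m"
    then show "(\<Sum>l<m. C (idx I i) l * A l (idx I j)) = (if i = j then 1 else 0)"
      by (simp add: C eq mem)
    show "(\<Sum>l<m. A i (idx I l) * C (idx I l) j) = (if i = j then 1 else 0)"
      using sum.reindex_bij_betw[OF bij, of "\<lambda>k. A i k * C k j"] C(2) \<open>i < m\<close> \<open>j < m\<close> by simp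
  qed
  then have "is_basis A m d I"
    using I T C(3) by (auto simp: is_basis_def invertible_sq_def good_def)
  with I show ?thesis by (intro that) (auto simp: good_def)
qed

text \<open>The basis is squeezed between the support of a feasible \<open>x\<close> and the active
  set of a dual feasible \<open>y\<close>. The first inclusion identifies its primal solution with
  \<open>x\<close>, the second its dual solution with \<open>y\<close>.\<close>

lemma lp_optimal_imp_optimal_basis:
  assumes rank: "full_row_rank A m d" and opt: "lp_optimal A c m d \<beta> x0"
  obtains I where "dual_feasible_basis A c m d I" "nonneg_vec d (xsol A m I \<beta>)"
proof -
  obtain y0 where y0: "\<And>j. j < d \<Longrightarrow> (\<Sum>i<m. A i j * y0 i) \<le> c j"
    "\<And>j. j < d \<Longrightarrow> x0 j \<noteq> 0 \<Longrightarrow> (\<Sum>i<m. A i j * y0 i) = c j"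
    using lp_complementary_slackness[OF opt] by blast
  have feas0: "lp_feasible A m d \<beta> x0" using opt by (simp add: lp_optimal_def)
  then have supp0: "{j. x0 j \<noteq> 0} \<subseteq> {..<d}"
    by (auto simp: lp_feasible_def vecs_def not_less[symmetric])
  obtain y where y: "\<And>j. j < d \<Longrightarrow> (\<Sum>i<m. A i j * y i) \<le> c j"
    and act: "{j. x0 j \<noteq> 0} \<subseteq> {j. j < d \<and> (\<Sum>i<m. A i j * y i) = c j}" (is "_ \<subseteq> ?T")
    and span: "\<And>z. (\<And>j. j < d \<Longrightarrow> (\<Sum>i<m. A i j * y i) = c j \<Longrightarrow> (\<Sum>i<m. A i j * z i) = 0) \<Longrightarrow>
      \<forall>i<m. z i = 0"
    by (rule exists_spanning_active_set[OF rank y0(1) _ supp0]) (use y0(2) supp0 in auto)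
  obtain x where x: "lp_feasible A m d \<beta> x" "{j. x j \<noteq> 0} \<subseteq> {j. x0 j \<noteq> 0}"
    "lin_indep_cols A m {j. x j \<noteq> 0}"
    using exists_independent_support[OF feas0] by blast
  obtain I where I: "is_basis A m d I" "{j. x j \<noteq> 0} \<subseteq> I" "I \<subseteq> ?T"
    by (rule extend_to_basis[OF x(3), of ?T d]) (use x(2) act span in auto)
  have "xsol A m I \<beta> = x" using I x(1) by (intro xsol_unique) (auto simp: lp_feasible_def)
  then have "nonneg_vec d (xsol A m I \<beta>)" using x(1) by (simp add: lp_feasible_def nonneg_vec_def)
  moreover have "dual_sol A c m I i = y i" if "i < m" for i
    using I(3) that by (intro dual_sol_unique[OF I(1)]) auto
  then have "dual_feasible_basis A c m d I" using I(1) y by (simp add: dual_feasible_basis_def)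
  ultimately show ?thesis using that by blast
qed

section \<open>Mapping theorem and null hyperplanes\<close>

context
  fixes g :: "'c::metric_space \<Rightarrow> real" and B :: real
  assumes bound: "\<And>x. \<bar>g x\<bar> \<le> B"
begin

text \<open>The Pasch-Hausdorff envelope, that is, the largest minorant of \<open>g\<close> with
  Lipschitz constant \<open>k\<close>. It supplies continuous test functions that converge to
  \<open>g\<close> from below wherever \<open>g\<close> is continuous.\<close>

definition lower_approx :: "nat \<Rightarrow> 'c \<Rightarrow> real" where
  "lower_approx k x = (INF y. g y + real k * dist x y)"

lemma lower_approx_bdd: "bdd_below (range (\<lambda>y. g y + real k * dist x y))"
proof (rule bdd_belowI2)
  show "- B \<le> g y + real k * dist x y" for y
    using bound[of y] mult_nonneg_nonneg[OF of_nat_0_le_iff zero_le_dist, of k x y] by linarith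
qed

lemma lower_approx_le: "lower_approx k x \<le> g x"
  unfolding lower_approx_def using cINF_lower[OF lower_approx_bdd[of k x] UNIV_I[of x]] by simp

lemma lower_approx_ge: "- B \<le> lower_approx k x"
  unfolding lower_approx_def
proof (rule cINF_greatest)
  show "- B \<le> g y + real k * dist x y" for y
    using bound[of y] mult_nonneg_nonneg[OF of_nat_0_le_iff zero_le_dist, of k x y] by linarith
qed simp

lemma lower_approx_abs: "\<bar>lower_approx k x\<bar> \<le> B"
  using lower_approx_le[of k x] lower_approx_ge[of k x] bound[of x] by linarith

lemma lower_approx_continuous: "continuous_on UNIV (lower_approx k)"
proof -
  have *: "lower_approx k x - real k * dist x y \<le> lower_approx k y" for x y
    unfolding lower_approx_def[of k y]
  proof (rule cINF_greatest)
    fix z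
    have "lower_approx k x \<le> g z + real k * dist x z"
      unfolding lower_approx_def by (rule cINF_lower[OF lower_approx_bdd]) simp
    also have "\<dots> \<le> g z + real k * (dist x y + dist y z)"
      by (intro add_left_mono mult_left_mono dist_triangle) simp
    finally show "lower_approx k x - real k * dist x y \<le> g z + real k * dist y z"
      by (simp add: algebra_simps)
  qed simp
  have "(real k)-lipschitz_on UNIV (lower_approx k)"
  proof (rule lipschitz_onI)
    show "dist (lower_approx k x) (lower_approx k y) \<le> real k * dist x y" for x y
      using *[of x y] *[of y x] by (auto simp: dist_real_def dist_commute abs_le_iff)
  qed simp
  then show ?thesis by (rule lipschitz_on_continuous_on)
qed

lemma lower_approx_tendsto:
  assumes "isCont g x"
  shows "(\<lambda>k. lower_approx k x) \<longlonglongrightarrow> g x"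
proof (rule LIMSEQ_I)
  fix e :: real assume e: "0 < e"
  then obtain \<delta> where \<delta>: "0 < \<delta>" "\<And>y. dist y x < \<delta> \<Longrightarrow> dist (g y) (g x) < e / 2"
    using assms unfolding continuous_at_eps_delta by (meson half_gt_zero)
  \<comment> \<open>From distance \<delta> on, the penalty is at least 2 B, which bounds g x - g y;
    only points closer than \<delta> can pull the infimum below g x.\<close>
  obtain k0 where k0: "2 * B / \<delta> \<le> real k0" using real_arch_simple by blast
  have "norm (lower_approx k x - g x) < e" if "k \<ge> k0" for k
  proof -
    have "g x - e / 2 \<le> lower_approx k x"
      unfolding lower_approx_def
    proof (rule cINF_greatest)
      fix y
      show "g x - e / 2 \<le> g y + real k * dist x y"
      proof (cases "dist y x < \<delta>")
        case True
        then have "\<bar>g y - g x\<bar> < e / 2" using \<delta>(2)[of y] by (simp add: dist_real_def)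
        then have "g x - e / 2 \<le> g y" by linarith
        then show ?thesis using mult_nonneg_nonneg[OF of_nat_0_le_iff zero_le_dist, of k x y] by linarith
      next
        case False
        have "2 * B / \<delta> \<le> real k" using k0 that by linarith
        then have "2 * B \<le> real k * \<delta>" using \<delta>(1) by (simp add: pos_divide_le_eq)
        also have "\<dots> \<le> real k * dist x y"
          using False by (intro mult_left_mono) (auto simp: dist_commute)
        finally show ?thesis using bound[of x] bound[of y] e by (auto simp: abs_le_iff)
      qed
    qed simp
    then show ?thesis using lower_approx_le[of k x] e by auto
  qed
  then show "\<exists>no. \<forall>n\<ge>no. norm (lower_approx n x - g x) < e" by blast
qed

end

lemma conv_distrD:
  fixes f :: "'c::topological_space \<Rightarrow> real"
  assumes "conv_distr M X N Y" "continuous_on UNIV f" "bounded (range f)"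
  shows "(\<lambda>n. \<integral>\<omega>. f (X n \<omega>) \<partial>M) \<longlonglongrightarrow> (\<integral>\<eta>. f (Y \<eta>) \<partial>N)"
  using assms by (simp add: conv_distr_def)

text \<open>One half of the mapping theorem. By dominated convergence some continuous minorant of
  \<open>g\<close> loses less than \<open>e\<close> in the limit integral; convergence in
  distribution applies to this minorant, and monotonicity passes the bound on to \<open>g\<close>.
  The other half follows by negating \<open>g\<close>.\<close>

lemma conv_distr_ae_continuous_lower:
  fixes g :: "'c::metric_space \<Rightarrow> real"
  assumes conv: "conv_distr M X N Y" and "prob_space M" "prob_space N"
    and X[measurable]: "\<And>n. X n \<in> borel_measurable M" and Y[measurable]: "Y \<in> borel_measurable N"
    and g[measurable]: "g \<in> borel_measurable borel" and bound: "\<And>x. \<bar>g x\<bar> \<le> B"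
    and cont: "AE \<eta> in N. isCont g (Y \<eta>)" and e: "0 < e"
  shows "\<forall>\<^sub>F n in sequentially. (\<integral>\<eta>. g (Y \<eta>) \<partial>N) - e < (\<integral>\<omega>. g (X n \<omega>) \<partial>M)"
proof -
  interpret M: prob_space M by fact
  interpret N: prob_space N by fact
  let ?h = "lower_approx g"
  have h[measurable]: "?h k \<in> borel_measurable borel" for k
    by (rule borel_measurable_continuous_onI[OF lower_approx_continuous[OF bound]])
  have h_abs: "\<bar>?h k x\<bar> \<le> B" for k x by (rule lower_approx_abs[OF bound])
  have "(\<lambda>k. \<integral>\<eta>. ?h k (Y \<eta>) \<partial>N) \<longlonglongrightarrow> (\<integral>\<eta>. g (Y \<eta>) \<partial>N)"
  proof (rule integral_dominated_convergence[where w = "\<lambda>_. B"])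
    show "AE \<eta> in N. (\<lambda>k. ?h k (Y \<eta>)) \<longlonglongrightarrow> g (Y \<eta>)"
      using cont by eventually_elim (rule lower_approx_tendsto[OF bound])
  qed (use h_abs in auto)
  then have "\<forall>\<^sub>F k in sequentially. (\<integral>\<eta>. g (Y \<eta>) \<partial>N) - e < (\<integral>\<eta>. ?h k (Y \<eta>) \<partial>N)"
    by (rule order_tendstoD) (use e in simp)
  then obtain k where k: "(\<integral>\<eta>. g (Y \<eta>) \<partial>N) - e < (\<integral>\<eta>. ?h k (Y \<eta>) \<partial>N)"
    by (auto simp: eventually_sequentially)
  have "bounded (range (?h k))"
    using h_abs by (auto simp: bounded_iff)
  then have "(\<lambda>n. \<integral>\<omega>. ?h k (X n \<omega>) \<partial>M) \<longlonglongrightarrow> (\<integral>\<eta>. ?h k (Y \<eta>) \<partial>N)"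
    by (rule conv_distrD[OF conv lower_approx_continuous[OF bound]])
  then have "\<forall>\<^sub>F n in sequentially. (\<integral>\<eta>. g (Y \<eta>) \<partial>N) - e < (\<integral>\<omega>. ?h k (X n \<omega>) \<partial>M)"
    by (rule order_tendstoD) (rule k)
  moreover have "(\<integral>\<omega>. ?h k (X n \<omega>) \<partial>M) \<le> (\<integral>\<omega>. g (X n \<omega>) \<partial>M)" for n
  proof (rule integral_mono)
    show "integrable M (\<lambda>\<omega>. ?h k (X n \<omega>))"
      by (rule M.integrable_const_bound[where B = B]) (use h_abs in auto)
    show "integrable M (\<lambda>\<omega>. g (X n \<omega>))"
      by (rule M.integrable_const_bound[where B = B]) (use bound in auto)
  qed (rule lower_approx_le[OF bound])
  ultimately show ?thesis by (auto elim!: eventually_mono intro: less_le_trans)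
qed

lemma conv_distr_ae_continuous:
  fixes g :: "'c::metric_space \<Rightarrow> real"
  assumes "conv_distr M X N Y" "prob_space M" "prob_space N"
    and "\<And>n. X n \<in> borel_measurable M" "Y \<in> borel_measurable N"
    and "g \<in> borel_measurable borel" and bound: "\<And>x. \<bar>g x\<bar> \<le> B"
    and cont: "AE \<eta> in N. isCont g (Y \<eta>)"
  shows "(\<lambda>n. \<integral>\<omega>. g (X n \<omega>) \<partial>M) \<longlonglongrightarrow> (\<integral>\<eta>. g (Y \<eta>) \<partial>N)"
proof (rule order_tendstoI)
  fix a assume "a < (\<integral>\<eta>. g (Y \<eta>) \<partial>N)"
  then show "\<forall>\<^sub>F n in sequentially. a < (\<integral>\<omega>. g (X n \<omega>) \<partial>M)"
    using conv_distr_ae_continuous_lower[OF assms, of "(\<integral>\<eta>. g (Y \<eta>) \<partial>N) - a"] by simp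
next
  fix a assume a: "(\<integral>\<eta>. g (Y \<eta>) \<partial>N) < a"
  have "AE \<eta> in N. isCont (\<lambda>x. - g x) (Y \<eta>)" using cont by eventually_elim (rule continuous_minus)
  then have "\<forall>\<^sub>F n in sequentially. (\<integral>\<eta>. - g (Y \<eta>) \<partial>N) - (a - (\<integral>\<eta>. g (Y \<eta>) \<partial>N))
      < (\<integral>\<omega>. - g (X n \<omega>) \<partial>M)"
    using assms a by (intro conv_distr_ae_continuous_lower[where B = B]) auto
  then show "\<forall>\<^sub>F n in sequentially. (\<integral>\<omega>. g (X n \<omega>) \<partial>M) < a" by simp
qed

text \<open>Fubini with coordinate \<open>l\<close> integrated first: once the other coordinates are
  fixed, a single value of \<open>v l\<close> lies on the hyperplane.\<close>

lemma AE_PiM_lborel_hyperplane: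
  fixes a :: "'i \<Rightarrow> real"
  assumes I: "finite I" "l \<in> I" and a: "a l \<noteq> 0"
  shows "AE v in Pi\<^sub>M I (\<lambda>_. lborel). (\<Sum>i\<in>I. a i * v i) \<noteq> 0"
proof -
  interpret product_sigma_finite "\<lambda>_. lborel" by standard
  define J where "J = I - {l}"
  have J: "finite J" "l \<notin> J" "I = insert l J" using I by (auto simp: J_def)
  let ?P = "Pi\<^sub>M (insert l J) (\<lambda>_. lborel :: real measure)"
  let ?S = "{v \<in> space ?P. (\<Sum>i\<in>insert l J. a i * v i) = 0}"
  have S[measurable]: "?S \<in> sets ?P" by measurable
  have "emeasure ?P ?S = (\<integral>\<^sup>+ v. indicator ?S v \<partial>?P)" by simp
  also have "\<dots> = (\<integral>\<^sup>+ x. (\<integral>\<^sup>+ y. indicator ?S (x(l := y)) \<partial>lborel) \<partial>(Pi\<^sub>M J (\<lambda>_. lborel)))"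
    using J by (intro product_nn_integral_insert) auto
  also have "\<dots> = (\<integral>\<^sup>+ x. 0 \<partial>(Pi\<^sub>M J (\<lambda>_. lborel :: real measure)))"
  proof (rule nn_integral_cong)
    fix x
    let ?t = "- (\<Sum>i\<in>J. a i * x i) / a l"
    have "(\<Sum>i\<in>insert l J. a i * (x(l := y)) i) = a l * y + (\<Sum>i\<in>J. a i * x i)" for y
    proof -
      have "(\<Sum>i\<in>J. a i * (x(l := y)) i) = (\<Sum>i\<in>J. a i * x i)"
        using J by (intro sum.cong) auto
      then show ?thesis using J by simp
    qed
    then have "y = ?t" if "(\<Sum>i\<in>insert l J. a i * (x(l := y)) i) = 0" for y
      using that a by (simp add: field_simps add_eq_0_iff)
    then have "indicator ?S (x(l := y)) \<le> (indicator {?t} y :: ennreal)" for y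
      by (auto simp: indicator_def)
    then have "(\<integral>\<^sup>+ y. indicator ?S (x(l := y)) \<partial>lborel) \<le> (\<integral>\<^sup>+ y. indicator {?t} y \<partial>lborel)"
      by (intro nn_integral_mono)
    then show "(\<integral>\<^sup>+ y. indicator ?S (x(l := y)) \<partial>lborel) = 0" by simp
  qed
  finally have "?S \<in> null_sets ?P" by (auto intro: null_setsI)
  then show ?thesis unfolding J(3) by (rule AE_I') auto
qed

lemma AE_absolutely_continuous_hyperplane:
  fixes G :: "'b \<Rightarrow> nat \<Rightarrow> real"
  assumes G[measurable]: "G \<in> borel_measurable Q"
    and ac: "absolutely_continuous (Pi\<^sub>M {..<n} (\<lambda>_. lborel))
      (distr Q (Pi\<^sub>M {..<n} (\<lambda>_. lborel)) (\<lambda>\<eta>. restrict (G \<eta>) {..<n}))"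
    and l: "l < n" "a l \<noteq> 0"
  shows "AE \<eta> in Q. (\<Sum>i<n. a i * G \<eta> i) \<noteq> 0"
proof -
  let ?P = "Pi\<^sub>M {..<n} (\<lambda>_. lborel :: real measure)" let ?R = "\<lambda>\<eta>. restrict (G \<eta>) {..<n}"
  have R: "?R \<in> measurable Q ?P"
    using measurable_product_then_coordinatewise[OF G] by (intro measurable_restrict) simp
  have "AE v in distr Q ?P ?R. (\<Sum>i<n. a i * v i) \<noteq> 0"
    by (rule absolutely_continuous_AE[OF _ ac AE_PiM_lborel_hyperplane[of _ l]]) (use l in auto)
  then have "AE \<eta> in Q. (\<Sum>i<n. a i * ?R \<eta> i) \<noteq> 0" by (rule AE_distrD[OF R])
  then show ?thesis by simp
qed

section \<open>Perturbation of the right-hand side\<close>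

lemma xsol_scaled_diff:
  "xsol A m I (\<lambda>i. t * (u i - v i)) = (\<lambda>i. t * (xsol A m I u i - xsol A m I v i))"
  by (auto simp: xsol_def fun_eq_iff sum_distrib_left sum_subtractf algebra_simps)

lemma xsol_small:
  assumes "0 < e"
  shows "\<exists>\<delta>>0. \<forall>v. (\<Sum>l<m. \<bar>v l\<bar>) < \<delta> \<longrightarrow> \<bar>xsol A m I v i\<bar> < e"
proof -
  define C where "C = (\<Sum>l<m. \<bar>inv_sq m (colsub A I) (card {j\<in>I. j < i}) l\<bar>)"
  have C: "0 \<le> C" by (simp add: C_def sum_nonneg)
  have bound: "\<bar>xsol A m I v i\<bar> \<le> C * (\<Sum>l<m. \<bar>v l\<bar>)" for v
  proof (cases "i \<in> I")
    case True
    have "\<bar>xsol A m I v i\<bar> \<le> (\<Sum>l<m. \<bar>inv_sq m (colsub A I) (card {j\<in>I. j < i}) l\<bar> * \<bar>v l\<bar>)"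
      using True by (auto simp: xsol_def abs_mult intro!: order_trans[OF sum_abs])
    also have "\<dots> \<le> (\<Sum>l<m. C * \<bar>v l\<bar>)"
      by (intro sum_mono mult_right_mono) (auto simp: C_def intro!: member_le_sum)
    finally show ?thesis by (simp add: sum_distrib_left)
  next
    case False
    then show ?thesis using C by (simp add: xsol_notin sum_nonneg)
  qed
  have "\<bar>xsol A m I v i\<bar> < e" if "(\<Sum>l<m. \<bar>v l\<bar>) < e / (C + 1)" for v
  proof -
    have "\<bar>xsol A m I v i\<bar> \<le> (C + 1) * (\<Sum>l<m. \<bar>v l\<bar>)"
      using bound[of v] by (rule order_trans) (intro mult_right_mono, auto intro: sum_nonneg)
    also have "\<dots> < e" using that C by (simp add: pos_less_divide_eq mult.commute)
    finally show ?thesis .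
  qed
  then show ?thesis using C assms by (intro exI[of _ "e / (C + 1)"]) auto
qed

lemma xsol_uniformly_small:
  assumes "finite P" "\<And>I i. (I, i) \<in> P \<Longrightarrow> 0 < e I i"
  obtains \<delta> where "0 < \<delta>"
    "\<And>v I i. (\<Sum>l<m. \<bar>v l\<bar>) < \<delta> \<Longrightarrow> (I, i) \<in> P \<Longrightarrow> \<bar>xsol A m I v i\<bar> < e I i"
proof -
  have "\<forall>p\<in>P. \<forall>\<^sub>F \<delta> in at_right 0. \<forall>v. (\<Sum>l<m. \<bar>v l\<bar>) < \<delta> \<longrightarrow> \<bar>xsol A m (fst p) v (snd p)\<bar> < e (fst p) (snd p)"
  proof
    fix p assume p: "p \<in> P"
    then have "0 < e (fst p) (snd p)" using assms(2)[of "fst p" "snd p"] by simp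
    then obtain \<delta>0 where \<delta>0: "\<delta>0 > 0"
      "\<forall>v. (\<Sum>l<m. \<bar>v l\<bar>) < \<delta>0 \<longrightarrow> \<bar>xsol A m (fst p) v (snd p)\<bar> < e (fst p) (snd p)"
      using xsol_small by blast
    show "\<forall>\<^sub>F \<delta> in at_right 0. \<forall>v. (\<Sum>l<m. \<bar>v l\<bar>) < \<delta> \<longrightarrow> \<bar>xsol A m (fst p) v (snd p)\<bar> < e (fst p) (snd p)"
      using eventually_at_right_real[OF \<delta>0(1)] by eventually_elim (use \<delta>0(2) in force)
  qed
  then have "\<forall>\<^sub>F \<delta> in at_right 0. \<forall>p\<in>P. \<forall>v. (\<Sum>l<m. \<bar>v l\<bar>) < \<delta> \<longrightarrow> \<bar>xsol A m (fst p) v (snd p)\<bar> < e (fst p) (snd p)"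
    by (rule eventually_ball_finite[OF assms(1)])
  moreover have "\<forall>\<^sub>F \<delta> in at_right 0. (0::real) < \<delta>" by (rule eventually_at_right_less)
  ultimately have "\<forall>\<^sub>F \<delta> in at_right 0. 0 < \<delta> \<and>
      (\<forall>p\<in>P. \<forall>v. (\<Sum>l<m. \<bar>v l\<bar>) < \<delta> \<longrightarrow> \<bar>xsol A m (fst p) v (snd p)\<bar> < e (fst p) (snd p))"
    by eventually_elim simp
  from eventually_happens'[OF trivial_limit_at_right_real this] show ?thesis
    by (metis that fst_conv snd_conv)
qed

lemma xstar_eq_xsol:
  assumes "\<exists>!x. lp_optimal A c m d b x" "dual_feasible_basis A c m d I" "nonneg_vec d (xsol A m I b)"
  shows "xstar A c m d b = xsol A m I b"
  unfolding xstar_def using assms dual_feasible_basis_optimal by (intro the1_equality) auto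

text \<open>Positive coordinates of x(I,b) survive the perturbation by \<open>small\<close>. At the
  remaining basic coordinates x(I,b) is 0, so the sign of x(I,\<beta>) is that of x(I,\<beta> - b),
  which is the cone inequality up to the positive factor \<open>t\<close>.\<close>

lemma feasible_iff_cone:
  assumes A2: "\<exists>!x. lp_optimal A c m d b x" and I: "dual_feasible_basis A c m d I"
    and nn: "nonneg_vec d (xsol A m I b)"
    and vecs: "b \<in> vecs m" "\<beta> \<in> vecs m" and eq: "\<And>i. m0 \<le> i \<Longrightarrow> i < m \<Longrightarrow> \<beta> i = b i" and t: "0 < t"
    and small: "\<And>i. i < d \<Longrightarrow> 0 < xsol A m I b i \<Longrightarrow>
      \<bar>xsol A m I (\<lambda>l. \<beta> l - b l) i\<bar> < xsol A m I b i"
  shows "nonneg_vec d (xsol A m I \<beta>) \<longleftrightarrow>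
    (\<lambda>i. t * (\<beta> i - b i)) \<in> Hcone A m m0 {j. 0 < xstar A c m d b j} I"
proof -
  let ?v = "\<lambda>i. t * (\<beta> i - b i)"
  have basis: "is_basis A m d I" using I by (simp add: dual_feasible_basis_def)
  have xstar: "xstar A c m d b = xsol A m I b" by (rule xstar_eq_xsol[OF A2 I nn])
  have lt: "idx I j < d" if "j < m" for j
    using is_basis_idx_mem[OF basis that] basis by (auto simp: is_basis_def)
  have v: "?v \<in> vecs m0"
  proof -
    have "\<beta> i = b i" if "m0 \<le> i" for i
      using that eq vecs by (cases "i < m") (auto simp: vecs_def)
    then show ?thesis by (simp add: vecs_def)
  qed
  have zero: "xsol A m I b i = 0" if "\<not> 0 < xsol A m I b i" "i < d" for i
    using nn that unfolding nonneg_vec_def by force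
  have row: "(\<Sum>l<m. inv_sq m (colsub A I) j l * ?v l) = t * (xsol A m I \<beta> (idx I j) - xsol A m I b (idx I j))"
    if "j < m" for j
    by (simp only: xsol_idx[OF basis that, symmetric] xsol_scaled_diff)
  have diff: "xsol A m I (\<lambda>l. \<beta> l - b l) = (\<lambda>i. xsol A m I \<beta> i - xsol A m I b i)"
    using xsol_scaled_diff[of A m I 1 \<beta> b] by simp
  show ?thesis
  proof
    assume nn': "nonneg_vec d (xsol A m I \<beta>)"
    have "0 \<le> (\<Sum>l<m. inv_sq m (colsub A I) j l * ?v l)"
      if "j < m" "idx I j \<notin> {j. 0 < xstar A c m d b j}" for j
      unfolding row[OF that(1)] using that lt nn' t by (simp add: zero xstar nonneg_vec_def)
    with v show "?v \<in> Hcone A m m0 {j. 0 < xstar A c m d b j} I" by (simp add: Hcone_def)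
  next
    assume H: "?v \<in> Hcone A m m0 {j. 0 < xstar A c m d b j} I"
    show "nonneg_vec d (xsol A m I \<beta>)"
      unfolding nonneg_vec_def
    proof (intro allI impI)
      fix i assume i: "i < d"
      show "0 \<le> xsol A m I \<beta> i"
      proof (cases "i \<in> I")
        case True
        then obtain j where j: "j < m" "i = idx I j"
          using is_basis_bij[OF basis] unfolding bij_betw_def by auto
        show ?thesis
        proof (cases "0 < xsol A m I b i")
          case True
          with small[OF i True] show ?thesis by (simp add: diff)
        next
          case False
          then have "0 \<le> (\<Sum>l<m. inv_sq m (colsub A I) j l * ?v l)"
            using H j by (auto simp: Hcone_def xstar)
          then show ?thesis using row[OF j(1)] j(2) t zero[OF False i] by (simp add: zero_le_mult_iff)
        qed
      qed (simp add: xsol_notin)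
    qed
  qed
qed

text \<open>The radius keeps x(I,\<beta> - b) below every nonzero coordinate of x(I,b), for all
  bases together. Then a basis infeasible for \<open>b\<close> retains a negative coordinate, and
  the others are decided by \<open>feasible_iff_cone\<close>. The radius is independent of
  \<open>t\<close>, so one \<delta> serves all \<open>r n\<close>.\<close>

lemma feasible_bases_near:
  fixes Nb Kb :: nat
  assumes bvec: "b \<in> vecs m"
    and enum: "bij_betw Ib {..<Nb} {I. dual_feasible_basis A c m d I}" and KN: "Kb \<le> Nb"
    and primal: "\<And>k. k < Nb \<Longrightarrow> (k < Kb \<longleftrightarrow> nonneg_vec d (xsol A m (Ib k) b))"
    and A2: "\<exists>!x. lp_optimal A c m d b x"
  obtains \<delta> where "0 < \<delta>"
    "\<And>\<beta> t m0. (\<Sum>l<m. \<bar>\<beta> l - b l\<bar>) < \<delta> \<Longrightarrow> 0 < t \<Longrightarrow> \<beta> \<in> vecs m \<Longrightarrow>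
      (\<And>i. m0 \<le> i \<Longrightarrow> i < m \<Longrightarrow> \<beta> i = b i) \<Longrightarrow>
      {k. k < Nb \<and> nonneg_vec d (xsol A m (Ib k) \<beta>)} =
      {k. k < Kb \<and> (\<lambda>i. t * (\<beta> i - b i)) \<in> Hcone A m m0 {j. 0 < xstar A c m d b j} (Ib k)}"
proof -
  define P where "P = {(I, i). I \<in> Ib ` {..<Nb} \<and> i < d \<and> xsol A m I b i \<noteq> 0}"
  have "finite P" by (rule finite_subset[of _ "Ib ` {..<Nb} \<times> {..<d}"]) (auto simp: P_def)
  then obtain \<delta> where \<delta>: "0 < \<delta>" and small: "\<And>v I i. (\<Sum>l<m. \<bar>v l\<bar>) < \<delta> \<Longrightarrow> (I, i) \<in> P \<Longrightarrow>
      \<bar>xsol A m I v i\<bar> < \<bar>xsol A m I b i\<bar>"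
    by (rule xsol_uniformly_small[of P "\<lambda>I i. \<bar>xsol A m I b i\<bar>" m A]) (auto simp: P_def)
  have dfb: "dual_feasible_basis A c m d (Ib k)" if "k < Nb" for k
    using bij_betwE[OF enum] that by simp
  have iff: "nonneg_vec d (xsol A m (Ib k) \<beta>) \<longleftrightarrow>
      k < Kb \<and> (\<lambda>i. t * (\<beta> i - b i)) \<in> Hcone A m m0 {j. 0 < xstar A c m d b j} (Ib k)"
    if near: "(\<Sum>l<m. \<bar>\<beta> l - b l\<bar>) < \<delta>" and "0 < t" "\<beta> \<in> vecs m"
      "\<And>i. m0 \<le> i \<Longrightarrow> i < m \<Longrightarrow> \<beta> i = b i" and k: "k < Nb" for \<beta> t m0 k
  proof (cases "k < Kb")
    case True
    have "\<bar>xsol A m (Ib k) (\<lambda>l. \<beta> l - b l) i\<bar> < xsol A m (Ib k) b i"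
      if "i < d" "0 < xsol A m (Ib k) b i" for i
      using small[of "\<lambda>l. \<beta> l - b l" "Ib k" i] near that k by (simp add: P_def)
    then show ?thesis
      using True primal[OF k] that bvec by (subst feasible_iff_cone[OF A2 dfb[OF k]]) auto
  next
    case False
    then obtain i where i: "i < d" "xsol A m (Ib k) b i < 0"
      using primal[OF k] by (auto simp: nonneg_vec_def not_le)
    then have "\<bar>xsol A m (Ib k) (\<lambda>l. \<beta> l - b l) i\<bar> < - xsol A m (Ib k) b i"
      using small[of "\<lambda>l. \<beta> l - b l" "Ib k" i] near k by (simp add: P_def)
    moreover have "xsol A m (Ib k) (\<lambda>l. \<beta> l - b l) i = xsol A m (Ib k) \<beta> i - xsol A m (Ib k) b i"
      using xsol_scaled_diff[of A m "Ib k" 1 \<beta> b] by simp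
    ultimately have "xsol A m (Ib k) \<beta> i < 0" by linarith
    then show ?thesis using i False by (auto simp: nonneg_vec_def not_le)
  qed
  show ?thesis
  proof (rule that[OF \<delta>])
    fix \<beta> m0 and t :: real
    assume prems: "(\<Sum>l<m. \<bar>\<beta> l - b l\<bar>) < \<delta>" "0 < t" "\<beta> \<in> vecs m"
      "\<And>i. m0 \<le> i \<Longrightarrow> i < m \<Longrightarrow> \<beta> i = b i"
    show "{k. k < Nb \<and> nonneg_vec d (xsol A m (Ib k) \<beta>)} =
      {k. k < Kb \<and> (\<lambda>i. t * (\<beta> i - b i)) \<in> Hcone A m m0 {j. 0 < xstar A c m d b j} (Ib k)}"
      using iff[OF prems] KN by (intro Collect_cong) (meson less_le_trans)
  qed
qed

text \<open>The \<open>m\<close> positive coordinates fill any basis that represents the optimum, so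
  such a basis equals the support. Injectivity of the enumeration leaves at most one, and
  solvability provides at least one.\<close>

lemma nondegenerate_unique_basis:
  fixes Nb Kb :: nat
  assumes rank: "full_row_rank A m d"
    and enum: "bij_betw Ib {..<Nb} {I. dual_feasible_basis A c m d I}" and KN: "Kb \<le> Nb"
    and primal: "\<And>k. k < Nb \<Longrightarrow> (k < Kb \<longleftrightarrow> nonneg_vec d (xsol A m (Ib k) b))"
    and A2: "\<exists>!x. lp_optimal A c m d b x"
    and nondeg: "nondegenerate m d (xstar A c m d b)"
  shows "Kb = 1" "Ib 0 = {i. i < d \<and> 0 < xstar A c m d b i}"
proof -
  obtain x where "lp_optimal A c m d b x" using A2 by blast
  then obtain I where I: "dual_feasible_basis A c m d I" "nonneg_vec d (xsol A m I b)"
    using lp_optimal_imp_optimal_basis[OF rank] by blast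
  then obtain k where "k < Nb" "I = Ib k" using bij_betw_imp_surj_on[OF enum] by blast
  then have "k < Kb" using I primal by blast
  have supp: "Ib k = {i. i < d \<and> 0 < xstar A c m d b i}" if k: "k < Kb" for k
  proof -
    have nn: "nonneg_vec d (xsol A m (Ib k) b)" using primal[of k] k KN by simp
    have dfb: "dual_feasible_basis A c m d (Ib k)" using bij_betwE[OF enum] k KN by auto
    then have basis: "is_basis A m d (Ib k)" by (simp add: dual_feasible_basis_def)
    have x: "xstar A c m d b = xsol A m (Ib k) b" by (rule xstar_eq_xsol[OF A2 dfb nn])
    have "{i\<in>{..<d}. xstar A c m d b i \<noteq> 0} = {i. i < d \<and> 0 < xstar A c m d b i}"
      using nn x by (force simp: nonneg_vec_def less_le)
    then have "card {i. i < d \<and> 0 < xstar A c m d b i} = card (Ib k)"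
      using nondeg basis by (simp add: nondegenerate_def is_basis_def)
    moreover have "{i. i < d \<and> 0 < xstar A c m d b i} \<subseteq> Ib k"
      using x xsol_notin by fastforce
    ultimately have "{i. i < d \<and> 0 < xstar A c m d b i} = Ib k"
      by (intro card_subset_eq is_basis_finite[OF basis])
    then show ?thesis by simp
  qed
  show "Kb = 1"
  proof (rule ccontr)
    assume "Kb \<noteq> 1"
    then have "0 < Kb" "1 < Kb" using \<open>k < Kb\<close> by auto
    then have "Ib 0 = Ib 1" using supp by simp
    then show False
      using inj_onD[OF bij_betw_imp_inj_on[OF enum], of 0 1] \<open>1 < Kb\<close> KN by simp
  qed
  then show "Ib 0 = {i. i < d \<and> 0 < xstar A c m d b i}" using supp by simp
qed

section \<open>Tightness of the scaled perturbation\<close>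

lemma conv_distr_tight:
  fixes s :: "'c::topological_space \<Rightarrow> real" and r :: "nat \<Rightarrow> real"
  assumes conv: "conv_distr M X N Y" and "prob_space M" "prob_space N"
    and X[measurable]: "\<And>n. X n \<in> borel_measurable M" and Y[measurable]: "Y \<in> borel_measurable N"
    and s: "continuous_on UNIV s" and r: "filterlim r at_top sequentially"
  shows "(\<lambda>n. measure M {\<omega> \<in> space M. r n \<le> s (X n \<omega>)}) \<longlonglongrightarrow> 0"
proof -
  interpret M: prob_space M by fact
  interpret N: prob_space N by fact
  have s_meas[measurable]: "s \<in> borel_measurable borel" using s by (rule borel_measurable_continuous_onI)
  \<comment> \<open>A continuous ramp, 0 up to s = k and 1 from s = k + 1 on. Once r n \<ge> k + 1
    it dominates the indicator of the event, and its limit integral is small for large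
    \<open>k\<close>.\<close>
  define h where "h k x = min 1 (max 0 (s x - real k))" for k :: nat and x
  have h_meas[measurable]: "h k \<in> borel_measurable borel" for k unfolding h_def by measurable
  have h: "0 \<le> h k x" "h k x \<le> 1" for k x by (auto simp: h_def)
  have "(\<lambda>k. \<integral>\<eta>. h k (Y \<eta>) \<partial>N) \<longlonglongrightarrow> (\<integral>\<eta>. 0 \<partial>N)"
  proof (rule integral_dominated_convergence[where w = "\<lambda>_. 1"])
    have "(\<lambda>k. h k x) \<longlonglongrightarrow> 0" for x
    proof (rule tendsto_eventually)
      obtain k0 where "s x \<le> real k0" using real_arch_simple by blast
      then have "\<forall>k\<ge>k0. h k x = 0" by (auto simp: h_def max_def)
      then show "\<forall>\<^sub>F k in sequentially. h k x = 0" by (auto simp: eventually_sequentially)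
    qed
    then show "AE \<eta> in N. (\<lambda>k. h k (Y \<eta>)) \<longlonglongrightarrow> 0" by simp
  qed (use h in auto)
  then have lim0: "(\<lambda>k. \<integral>\<eta>. h k (Y \<eta>) \<partial>N) \<longlonglongrightarrow> 0" by simp
  show ?thesis
  proof (rule order_tendstoI)
    fix e :: real assume "0 < e"
    with lim0 have "\<forall>\<^sub>F k in sequentially. (\<integral>\<eta>. h k (Y \<eta>) \<partial>N) < e" by (rule order_tendstoD)
    then obtain k where k: "(\<integral>\<eta>. h k (Y \<eta>) \<partial>N) < e" by (auto simp: eventually_sequentially)
    have "(\<lambda>n. \<integral>\<omega>. h k (X n \<omega>) \<partial>M) \<longlonglongrightarrow> (\<integral>\<eta>. h k (Y \<eta>) \<partial>N)"
    proof (rule conv_distrD[OF conv])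
      show "continuous_on UNIV (h k)" unfolding h_def by (intro continuous_intros s)
      show "bounded (range (h k))" using h by (intro boundedI[of _ 1]) auto
    qed
    then have "\<forall>\<^sub>F n in sequentially. (\<integral>\<omega>. h k (X n \<omega>) \<partial>M) < e" by (rule order_tendstoD) (rule k)
    moreover have "\<forall>\<^sub>F n in sequentially. real k + 1 \<le> r n" using r by (simp add: filterlim_at_top)
    ultimately show "\<forall>\<^sub>F n in sequentially. measure M {\<omega> \<in> space M. r n \<le> s (X n \<omega>)} < e"
    proof eventually_elim
      case (elim n)
      let ?S = "{\<omega> \<in> space M. r n \<le> s (X n \<omega>)}"
      have S: "?S \<in> sets M" by measurable
      have "measure M ?S = (\<integral>\<omega>. indicator ?S \<omega> \<partial>M)" using S by simp
      also have "\<dots> \<le> (\<integral>\<omega>. h k (X n \<omega>) \<partial>M)"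
      proof (rule integral_mono)
        show "integrable M (\<lambda>\<omega>. indicator ?S \<omega> :: real)" using S by (simp add: M.emeasure_eq_measure)
        show "integrable M (\<lambda>\<omega>. h k (X n \<omega>))"
          by (rule M.integrable_const_bound[where B = 1]) (use h in auto)
        show "indicator ?S \<omega> \<le> h k (X n \<omega>)" for \<omega>
          using elim(2) h by (auto simp: indicator_def h_def)
      qed
      finally show ?case using elim by simp
    qed
  next
    show "\<forall>\<^sub>F n in sequentially. a < measure M {\<omega> \<in> space M. r n \<le> s (X n \<omega>)}" if "a < 0" for a
      using that by (intro always_eventually allI) (simp add: less_le_trans)
  qed
qed

section \<open>Feasibility patterns\<close>

definition pattern :: "(nat \<Rightarrow> 'v set) \<Rightarrow> nat \<Rightarrow> nat set \<Rightarrow> 'v set" where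
  "pattern T n K = {v. \<forall>k<n. v \<in> T k \<longleftrightarrow> k \<in> K}"

text \<open>The patterns partition the space, so a quantity indexed by the random set of cones
  containing \<open>v\<close> becomes a finite sum over fixed sets.\<close>

lemma sum_pattern:
  fixes h :: "nat set \<Rightarrow> real"
  shows "(\<Sum>K\<in>Pow {..<n}. indicator (pattern T n K) v * h K) = h {k. k < n \<and> v \<in> T k}"
proof -
  let ?K = "{k. k < n \<and> v \<in> T k}"
  have "v \<in> pattern T n K \<longleftrightarrow> K = ?K" if "K \<subseteq> {..<n}" for K
    using that unfolding pattern_def by blast
  then have "(\<Sum>K\<in>Pow {..<n}. indicator (pattern T n K) v * h K) =
      (\<Sum>K\<in>Pow {..<n}. if K = ?K then h K else 0)"
    by (intro sum.cong refl) (simp only: Pow_iff indicator_def, simp)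
  also have "\<dots> = h ?K" by (subst sum.delta) auto
  finally show ?thesis .
qed

lemma Inter_minus_Union_eq_pattern:
  "K \<subseteq> {..<n} \<Longrightarrow> (\<Inter>k\<in>K. T k) - (\<Union>k\<in>{..<n} - K. T k) = pattern T n K"
  by (auto simp: pattern_def)

text \<open>The cone \<^const>\<open>Hcone\<close> carries the constraint that the last coordinates vanish, which makes it
  nowhere dense. Its extension by a product with the remaining coordinates has a negligible boundary.\<close>

definition Hcone_ext :: "(nat \<Rightarrow> nat \<Rightarrow> real) \<Rightarrow> nat \<Rightarrow> nat \<Rightarrow> nat set \<Rightarrow> nat set \<Rightarrow> (nat \<Rightarrow> real) set" where
  "Hcone_ext A m m0 Pos I = {v. \<forall>j<m. idx I j \<notin> Pos \<longrightarrow>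
       0 \<le> (\<Sum>l<m0. inv_sq m (colsub A I) j l * v l)}"

lemma Hcone_eq_ext:
  assumes "v \<in> vecs m0" "m0 \<le> m"
  shows "v \<in> Hcone A m m0 Pos I \<longleftrightarrow> v \<in> Hcone_ext A m m0 Pos I"
proof -
  have "(\<Sum>l<m. w l * v l) = (\<Sum>l<m0. w l * v l)" for w :: "nat \<Rightarrow> real"
    using assms by (intro sum.mono_neutral_right) (auto simp: vecs_def)
  with assms(1) show ?thesis by (simp add: Hcone_def Hcone_ext_def)
qed

lemma pattern_Hcone_eq_ext:
  assumes "v \<in> vecs m0" "m0 \<le> m"
  shows "v \<in> pattern (\<lambda>k. Hcone A m m0 Pos (Ib k)) n K \<longleftrightarrow>
    v \<in> pattern (\<lambda>k. Hcone_ext A m m0 Pos (Ib k)) n K"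
  using Hcone_eq_ext[OF assms] by (simp add: pattern_def)

lemma pattern_Hcone_ext_measurable:
  "pattern (\<lambda>k. Hcone_ext A m m0 Pos (Ib k)) n K \<in> sets borel"
proof -
  have "{v \<in> space borel. \<forall>k<n. (\<forall>j<m. idx (Ib k) j \<notin> Pos \<longrightarrow>
      0 \<le> (\<Sum>l<m0. inv_sq m (colsub A (Ib k)) j l * v l)) \<longleftrightarrow> k \<in> K} \<in> sets borel"
    by measurable
  then show ?thesis by (simp add: pattern_def Hcone_ext_def)
qed

lemma eventually_nonneg_iff:
  fixes \<phi> :: "'v::t2_space \<Rightarrow> real"
  assumes "continuous_on UNIV \<phi>" "\<phi> v \<noteq> 0"
  shows "\<forall>\<^sub>F w in nhds v. 0 \<le> \<phi> w \<longleftrightarrow> 0 \<le> \<phi> v"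
proof -
  have lim: "(\<phi> \<longlongrightarrow> \<phi> v) (nhds v)"
    using assms(1) continuous_on_eq_continuous_at[OF open_UNIV, of \<phi>]
    by (simp add: isCont_def tendsto_at_iff_tendsto_nhds[of \<phi> v, symmetric])
  show ?thesis
  proof (cases "0 < \<phi> v")
    case True
    from order_tendstoD(1)[OF lim this] show ?thesis by eventually_elim (use True in auto)
  next
    case False
    then have "\<phi> v < 0" using assms(2) by simp
    from order_tendstoD(2)[OF lim this] show ?thesis by eventually_elim (use \<open>\<phi> v < 0\<close> in auto)
  qed
qed

text \<open>Membership in a cone can change only where the sign of a truncated row changes. A row
  that is zero on the first \<open>m0\<close> entries gives a constraint true everywhere, which
  accounts for the first alternative.\<close>

lemma eventually_pattern_iff:
  assumes "\<And>k j. k < n \<Longrightarrow> j < m \<Longrightarrow> (\<forall>l<m0. inv_sq m (colsub A (Ib k)) j l = 0) \<or>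
      (\<Sum>l<m0. inv_sq m (colsub A (Ib k)) j l * v l) \<noteq> 0"
  shows "\<forall>\<^sub>F w in nhds v. w \<in> pattern (\<lambda>k. Hcone_ext A m m0 Pos (Ib k)) n K \<longleftrightarrow>
    v \<in> pattern (\<lambda>k. Hcone_ext A m m0 Pos (Ib k)) n K"
proof -
  let ?\<phi> = "\<lambda>k j w. \<Sum>l<m0. inv_sq m (colsub A (Ib k)) j l * w l"
  have "\<forall>p\<in>{..<n} \<times> {..<m}. \<forall>\<^sub>F w in nhds v.
      0 \<le> ?\<phi> (fst p) (snd p) w \<longleftrightarrow> 0 \<le> ?\<phi> (fst p) (snd p) v"
  proof
    fix p assume p: "p \<in> {..<n} \<times> {..<m}"
    show "\<forall>\<^sub>F w in nhds v. 0 \<le> ?\<phi> (fst p) (snd p) w \<longleftrightarrow> 0 \<le> ?\<phi> (fst p) (snd p) v"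
    proof (cases "\<forall>l<m0. inv_sq m (colsub A (Ib (fst p))) (snd p) l = 0")
      case False
      then have "?\<phi> (fst p) (snd p) v \<noteq> 0" using assms[of "fst p" "snd p"] p by auto
      then show ?thesis
        by (intro eventually_nonneg_iff) (intro continuous_intros continuous_on_product_coordinates)
    qed simp
  qed
  then have "\<forall>\<^sub>F w in nhds v. \<forall>p\<in>{..<n} \<times> {..<m}.
      0 \<le> ?\<phi> (fst p) (snd p) w \<longleftrightarrow> 0 \<le> ?\<phi> (fst p) (snd p) v"
    by (rule eventually_ball_finite[rotated]) simp
  then show ?thesis
  proof eventually_elim
    case (elim w)
    then have "w \<in> Hcone_ext A m m0 Pos (Ib k) \<longleftrightarrow> v \<in> Hcone_ext A m m0 Pos (Ib k)" if "k < n" for k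
      using that by (force simp: Hcone_ext_def)
    then show ?case by (simp add: pattern_def)
  qed
qed

lemma continuous_on_xsol:
  assumes "continuous_on S f"
  shows "continuous_on S (\<lambda>x. xsol A m I (f x) i)"
proof (cases "i \<in> I")
  case True
  have "continuous_on S (\<lambda>x. f x l)" for l by (rule continuous_on_product_then_coordinatewise[OF assms])
  then have "continuous_on S (\<lambda>x. \<Sum>l<m. inv_sq m (colsub A I) (card {j\<in>I. j < i}) l * f x l)"
    by (intro continuous_on_sum continuous_on_mult continuous_on_const)
  then show ?thesis using True by (simp add: xsol_def)
qed (simp add: xsol_notin)

lemma continuous_on_otimes:
  "continuous_on UNIV (\<lambda>p. otimes A m Ib K (fst p) (snd p))"
proof -
  have "continuous_on UNIV (\<lambda>p :: (nat \<Rightarrow> real) \<times> (nat \<Rightarrow> real). fst p k)" for k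
    by (rule continuous_on_product_then_coordinatewise[OF continuous_on_fst[OF continuous_on_id]])
  moreover have "continuous_on UNIV (\<lambda>p :: (nat \<Rightarrow> real) \<times> (nat \<Rightarrow> real). xsol A m I (snd p) i)" for I i
    by (rule continuous_on_xsol[OF continuous_on_snd[OF continuous_on_id]])
  ultimately show ?thesis
    unfolding otimes_def
    by (intro continuous_on_coordinatewise_then_product continuous_on_sum continuous_on_mult)
qed

text \<open>The limit of one summand. Near a generic \<open>G\<close> the indicator is constant, so
  the integrand is locally a constant times a continuous function. The weights \<open>al\<close> are
  not tied to \<open>K\<close>, which lets the empty pattern borrow the joint limit of another
  set.\<close>

lemma conv_distr_pattern:
  fixes f :: "(nat \<Rightarrow> real) \<Rightarrow> real"
  assumes conv: "conv_distr M (\<lambda>n \<omega>. (al n \<omega>, Gn n \<omega>)) Q (\<lambda>\<eta>. (al' \<eta>, G \<eta>))"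
    and "prob_space M" "prob_space Q"
    and meas[measurable]: "\<And>n. al n \<in> borel_measurable M" "\<And>n. Gn n \<in> borel_measurable M"
      "al' \<in> borel_measurable Q" "G \<in> borel_measurable Q"
    and f: "continuous_on UNIV f" and bound: "\<And>x. \<bar>f x\<bar> \<le> B"
    and gen: "AE \<eta> in Q. \<forall>k<n0. \<forall>j<m. (\<forall>l<m0. inv_sq m (colsub A (Ib k)) j l = 0) \<or>
      (\<Sum>l<m0. inv_sq m (colsub A (Ib k)) j l * G \<eta> l) \<noteq> 0"
  shows "(\<lambda>n. \<integral>\<omega>. indicator (pattern (\<lambda>k. Hcone_ext A m m0 Pos (Ib k)) n0 K) (Gn n \<omega>) *
        f (otimes A m Ib K' (al n \<omega>) (Gn n \<omega>)) \<partial>M) \<longlonglongrightarrow>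
      (\<integral>\<eta>. indicator (pattern (\<lambda>k. Hcone_ext A m m0 Pos (Ib k)) n0 K) (G \<eta>) *
        f (otimes A m Ib K' (al' \<eta>) (G \<eta>)) \<partial>Q)"
proof -
  let ?S = "pattern (\<lambda>k. Hcone_ext A m m0 Pos (Ib k)) n0 K"
  let ?f = "\<lambda>p. f (otimes A m Ib K' (fst p) (snd p))"
  let ?g = "\<lambda>p. indicator ?S (snd p) * ?f p"
  have cont_f: "continuous_on UNIV ?f"
    by (rule continuous_on_compose2[OF f continuous_on_otimes]) simp
  have [measurable]: "?S \<in> sets borel" by (rule pattern_Hcone_ext_measurable)
  have [measurable]: "?f \<in> borel_measurable borel"
    by (rule borel_measurable_continuous_onI[OF cont_f])
  have snd_meas[measurable]: "(snd :: (nat \<Rightarrow> real) \<times> (nat \<Rightarrow> real) \<Rightarrow> _) \<in> borel_measurable borel"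
    by (intro borel_measurable_continuous_onI continuous_on_snd continuous_on_id)
  have B: "0 \<le> B" using bound[of undefined] by linarith
  have "(\<lambda>n. \<integral>\<omega>. ?g (al n \<omega>, Gn n \<omega>) \<partial>M) \<longlonglongrightarrow> (\<integral>\<eta>. ?g (al' \<eta>, G \<eta>) \<partial>Q)"
  proof (rule conv_distr_ae_continuous[OF conv assms(2,3)])
    show "\<bar>?g p\<bar> \<le> B" for p using bound B by (auto simp: indicator_def)
    show "AE \<eta> in Q. isCont ?g (al' \<eta>, G \<eta>)"
      using gen
    proof eventually_elim
      case (elim \<eta>)
      have "\<forall>\<^sub>F w in nhds (G \<eta>). w \<in> ?S \<longleftrightarrow> G \<eta> \<in> ?S"
        by (rule eventually_pattern_iff) (use elim in blast)
      moreover have "filterlim snd (nhds (G \<eta>)) (nhds (al' \<eta>, G \<eta>))"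
        using tendsto_snd[OF tendsto_ident_at, of "(al' \<eta>, G \<eta>)" UNIV]
          tendsto_at_iff_tendsto_nhds[of snd "(al' \<eta>, G \<eta>)"] by simp
      ultimately have "\<forall>\<^sub>F p in nhds (al' \<eta>, G \<eta>). snd p \<in> ?S \<longleftrightarrow> G \<eta> \<in> ?S"
        by (rule eventually_compose_filterlim)
      then have "\<forall>\<^sub>F p in nhds (al' \<eta>, G \<eta>). ?g p = indicator ?S (G \<eta>) * ?f p"
        by eventually_elim (simp add: indicator_def)
      then have "isCont ?g (al' \<eta>, G \<eta>) \<longleftrightarrow> isCont (\<lambda>p. indicator ?S (G \<eta>) * ?f p) (al' \<eta>, G \<eta>)"
        by (rule isCont_cong)
      moreover have "isCont ?f (al' \<eta>, G \<eta>)"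
        using cont_f continuous_on_eq_continuous_at[OF open_UNIV] by blast
      ultimately show ?case by (simp add: continuous_mult_left)
    qed
  qed measurable
  then show ?thesis by simp
qed

lemma conv_distr_limit_cong:
  fixes Y :: "'b \<Rightarrow> 'c::topological_space"
  assumes "\<And>\<eta>. \<eta> \<in> space N \<Longrightarrow> Y \<eta> = Y' \<eta>"
  shows "conv_distr M X N Y \<longleftrightarrow> conv_distr M X N Y'"
proof -
  have "(\<integral>\<eta>. f (Y \<eta>) \<partial>N) = (\<integral>\<eta>. f (Y' \<eta>) \<partial>N)" for f :: "'c \<Rightarrow> real"
    using assms by (intro Bochner_Integration.integral_cong) auto
  then show ?thesis by (simp add: conv_distr_def)
qed

lemma otimes_empty: "otimes A m Ib {} a v = (\<lambda>_. 0)"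
  by (simp add: otimes_def)

text \<open>The weights sum to 1, so \<open>z\<close> is itself the weighted combination of the
  basic solutions for \<open>b\<close>; linearity of \<open>xsol\<close> does the rest.\<close>

lemma scaled_error_eq_otimes:
  assumes "finite K" "\<alpha> \<in> simplex_on K" "\<And>k. k \<in> K \<Longrightarrow> xsol A m (Ib k) b = z"
  shows "(\<lambda>i. t * (otimes A m Ib K \<alpha> \<beta> i - z i)) = otimes A m Ib K \<alpha> (\<lambda>i. t * (\<beta> i - b i))"
proof
  fix i
  have "z i = (\<Sum>k\<in>K. \<alpha> k * xsol A m (Ib k) b i)"
    using assms by (simp add: simplex_on_def flip: sum_distrib_right)
  then show "t * (otimes A m Ib K \<alpha> \<beta> i - z i) = otimes A m Ib K \<alpha> (\<lambda>i. t * (\<beta> i - b i)) i"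
    unfolding otimes_def xsol_scaled_diff
    by (simp add: sum_distrib_left algebra_simps flip: sum_subtractf)
qed

section \<open>Convergence in distribution\<close>

lemma measurable_scaled_diff:
  assumes "X \<in> borel_measurable M"
  shows "(\<lambda>\<omega>. (\<lambda>i. t * (X \<omega> i - b i)) :: nat \<Rightarrow> real) \<in> borel_measurable M"
proof (rule measurable_coordinatewise_then_product)
  fix i
  have [measurable]: "(\<lambda>\<omega>. X \<omega> i) \<in> borel_measurable M"
    by (rule measurable_product_then_coordinatewise[OF assms])
  show "(\<lambda>\<omega>. t * (X \<omega> i - b i)) \<in> borel_measurable M" by measurable
qed

lemma AE_constraints_generic:
  fixes G :: "'b \<Rightarrow> nat \<Rightarrow> real" and w :: "nat \<Rightarrow> nat \<Rightarrow> nat \<Rightarrow> real"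
  assumes "G \<in> borel_measurable Q"
    and "absolutely_continuous (Pi\<^sub>M {..<n} (\<lambda>_. lborel))
      (distr Q (Pi\<^sub>M {..<n} (\<lambda>_. lborel)) (\<lambda>\<eta>. restrict (G \<eta>) {..<n}))"
  shows "AE \<eta> in Q. \<forall>k<p. \<forall>j<m. (\<forall>l<n. w k j l = 0) \<or> (\<Sum>l<n. w k j l * G \<eta> l) \<noteq> 0"
proof -
  have "AE \<eta> in Q. (\<forall>l<n. w k j l = 0) \<or> (\<Sum>l<n. w k j l * G \<eta> l) \<noteq> 0" for k j
  proof (cases "\<forall>l<n. w k j l = 0")
    case False
    then obtain l where "l < n" "w k j l \<noteq> 0" by blast
    from AE_absolutely_continuous_hyperplane[where a = "w k j", OF assms this]
    show ?thesis by eventually_elim simp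
  qed simp
  then have "AE \<eta> in Q. \<forall>k j. (\<forall>l<n. w k j l = 0) \<or> (\<Sum>l<n. w k j l * G \<eta> l) \<noteq> 0"
    by (simp add: AE_all_countable)
  then show ?thesis by eventually_elim blast
qed

text \<open>On \<open>E n\<close> outside \<open>D n\<close> the integrands agree, elsewhere they
  differ by at most 2 B. Measurability of \<open>E n\<close> for large \<open>n\<close> is extracted
  from its measure being positive.\<close>

lemma integral_difference_tendsto_0:
  fixes F T :: "nat \<Rightarrow> 'a \<Rightarrow> real"
  assumes "prob_space M"
    and meas[measurable]: "\<And>n. F n \<in> borel_measurable M" "\<And>n. T n \<in> borel_measurable M"
    and bound: "\<And>n \<omega>. \<bar>F n \<omega>\<bar> \<le> B" "\<And>n \<omega>. \<bar>T n \<omega>\<bar> \<le> B"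
    and E: "(\<lambda>n. measure M (E n)) \<longlonglongrightarrow> 1" "\<And>n. E n \<subseteq> space M"
    and D: "(\<lambda>n. measure M (D n)) \<longlonglongrightarrow> 0" and D_sets[measurable]: "\<And>n. D n \<in> sets M"
    and eq: "\<And>n \<omega>. \<omega> \<in> E n \<Longrightarrow> \<omega> \<notin> D n \<Longrightarrow> F n \<omega> = T n \<omega>"
  shows "(\<lambda>n. (\<integral>\<omega>. F n \<omega> \<partial>M) - (\<integral>\<omega>. T n \<omega> \<partial>M)) \<longlonglongrightarrow> 0"
proof -
  interpret prob_space M by fact
  have B: "0 \<le> B" using bound(1)[of 0 undefined] by linarith
  have int: "integrable M (F n)" "integrable M (T n)" for n
    using bound by (auto intro!: integrable_const_bound[where B = B])
  show ?thesis
  proof (rule Lim_null_comparison)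
    have "(\<lambda>n. 2 * B * ((1 - measure M (E n)) + measure M (D n))) \<longlonglongrightarrow> 2 * B * ((1 - 1) + 0)"
      by (intro tendsto_intros E D)
    then show "(\<lambda>n. 2 * B * ((1 - measure M (E n)) + measure M (D n))) \<longlonglongrightarrow> 0" by simp
    have "\<forall>\<^sub>F n in sequentially. 0 < measure M (E n)" by (rule order_tendstoD(1)[OF E(1)]) simp
    then show "\<forall>\<^sub>F n in sequentially. norm ((\<integral>\<omega>. F n \<omega> \<partial>M) - (\<integral>\<omega>. T n \<omega> \<partial>M))
        \<le> 2 * B * ((1 - measure M (E n)) + measure M (D n))"
    proof eventually_elim
      case (elim n)
      \<comment> \<open>Non-measurable sets have measure 0.\<close>
      then have E_sets[measurable]: "E n \<in> sets M" using measure_notin_sets by fastforce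
      let ?C = "(space M - E n) \<union> D n"
      have C: "?C \<in> sets M" by measurable
      have "norm ((\<integral>\<omega>. F n \<omega> \<partial>M) - (\<integral>\<omega>. T n \<omega> \<partial>M)) = norm (\<integral>\<omega>. F n \<omega> - T n \<omega> \<partial>M)"
        using int by simp
      also have "\<dots> \<le> (\<integral>\<omega>. \<bar>F n \<omega> - T n \<omega>\<bar> \<partial>M)"
        using integral_norm_bound[of M "\<lambda>\<omega>. F n \<omega> - T n \<omega>"] by simp
      also have "\<dots> \<le> (\<integral>\<omega>. 2 * B * indicator ?C \<omega> \<partial>M)"
      proof (rule integral_mono)
        show "integrable M (\<lambda>\<omega>. \<bar>F n \<omega> - T n \<omega>\<bar>)" using int by simp
        show "integrable M (\<lambda>\<omega>. 2 * B * indicator ?C \<omega>)" using C by (simp add: emeasure_eq_measure)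
        show "\<bar>F n \<omega> - T n \<omega>\<bar> \<le> 2 * B * indicator ?C \<omega>" if "\<omega> \<in> space M" for \<omega>
        proof (cases "\<omega> \<in> ?C")
          case True
          then show ?thesis using bound(1)[of n \<omega>] bound(2)[of n \<omega>] by simp
        next
          case False
          then show ?thesis using eq[of \<omega> n] that by simp
        qed
      qed
      also have "\<dots> = 2 * B * measure M ?C" using C by simp
      also have "\<dots> \<le> 2 * B * (measure M (space M - E n) + measure M (D n))"
        using B by (intro mult_left_mono measure_Un_le) auto
      also have "measure M (space M - E n) = 1 - measure M (E n)" by (rule prob_compl) simp
      finally show ?case .
    qed
  qed
qed

theorem theorem3p1:
  fixes A :: "nat \<Rightarrow> nat \<Rightarrow> real" and b c :: "nat \<Rightarrow> real" and m d :: nat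
    and Nb Kb :: nat and Ib :: "nat \<Rightarrow> nat set"
    and M :: "'a measure" and Q :: "'b measure"
    and r :: "nat \<Rightarrow> real" and m0 :: nat
    and bn :: "nat \<Rightarrow> 'a \<Rightarrow> (nat \<Rightarrow> real)"
    and G :: "'b \<Rightarrow> (nat \<Rightarrow> real)"
    and xs :: "nat \<Rightarrow> 'a \<Rightarrow> (nat \<Rightarrow> real)"
    and alphan :: "nat \<Rightarrow> nat set \<Rightarrow> 'a \<Rightarrow> (nat \<Rightarrow> real)"
    and alpha :: "nat set \<Rightarrow> 'b \<Rightarrow> (nat \<Rightarrow> real)"
  assumes mld: "m \<le> d" and rank: "full_row_rank A m d"
    and bvec: "b \<in> vecs m" and cvec: "c \<in> vecs d"
    \<comment> \<open>enumeration I_1..I_N of all dual feasible bases, I_1..I_K exactly those with x(I_k,b) >= 0\<close>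
    and enum: "bij_betw Ib {..<Nb} {I. dual_feasible_basis A c m d I}"
    and KN: "Kb \<le> Nb"
    and primal: "\<And>k. k < Nb \<Longrightarrow> (k < Kb \<longleftrightarrow> nonneg_vec d (xsol A m (Ib k) b))"
    \<comment> \<open>(A2)\<close>
    and A2: "\<exists>!x. lp_optimal A c m d b x"
    \<comment> \<open>stochastic setting\<close>
    and M_prob: "prob_space M" and Q_prob: "prob_space Q"
    and r_pos: "\<And>n. r n > 0" and r_lim: "filterlim r at_top sequentially"
    and m0: "1 \<le> m0" "m0 \<le> m"
    and bn_meas: "\<And>n. bn n \<in> borel_measurable M"
    and bn_vec: "\<And>n \<omega>. \<omega> \<in> space M \<Longrightarrow> bn n \<omega> \<in> vecs m"
    and bn_fixed: "\<And>n \<omega> i. \<omega> \<in> space M \<Longrightarrow> m0 \<le> i \<Longrightarrow> i < m \<Longrightarrow> bn n \<omega> i = b i"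
    \<comment> \<open>(B1)\<close>
    and G_meas: "G \<in> borel_measurable Q"
    and G_vec: "\<And>\<eta> i. \<eta> \<in> space Q \<Longrightarrow> m0 \<le> i \<Longrightarrow> G \<eta> i = 0"
    and G_ac: "absolutely_continuous (Pi\<^sub>M {..<m0} (\<lambda>_. lborel))
                 (distr Q (Pi\<^sub>M {..<m0} (\<lambda>_. lborel)) (\<lambda>\<eta>. restrict (G \<eta>) {..<m0}))"
    and B1: "conv_distr M (\<lambda>n \<omega>. (\<lambda>i. r n * (bn n \<omega> i - b i))) Q G"
    \<comment> \<open>(B2)\<close>
    and B2: "(\<lambda>n. prob_space.prob M {\<omega> \<in> space M. \<exists>x. lp_optimal A c m d (bn n \<omega>) x})
               \<longlonglongrightarrow> 1"
    \<comment> \<open>x*(b_n): any measurable choice of an optimal solution of (P_{b_n})\<close>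
    and xs_meas: "\<And>n. xs n \<in> borel_measurable M"
    and xs_opt: "\<And>n \<omega>. \<omega> \<in> space M \<Longrightarrow> (\<exists>x. lp_optimal A c m d (bn n \<omega>) x) \<Longrightarrow>
                   lp_optimal A c m d (bn n \<omega>) (xs n \<omega>)"
    \<comment> \<open>weights alpha_n^K\<close>
    and alphan_meas: "\<And>n K. alphan n K \<in> borel_measurable M"
    and alphan_simplex: "\<And>n K \<omega>. K \<noteq> {} \<Longrightarrow> K \<subseteq> {..<Nb} \<Longrightarrow> \<omega> \<in> space M \<Longrightarrow>
                   alphan n K \<omega> \<in> simplex_on K"
    and alphan_weights: "\<And>n K \<omega>. K \<noteq> {} \<Longrightarrow> K \<subseteq> {..<Nb} \<Longrightarrow> \<omega> \<in> space M \<Longrightarrow>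
                   {k. k < Nb \<and> nonneg_vec d (xsol A m (Ib k) (bn n \<omega>))} = K \<Longrightarrow>
                   xs n \<omega> = otimes A m Ib K (alphan n K \<omega>) (bn n \<omega>)"
    \<comment> \<open>joint convergence (alpha_n^K, G_n) -> (alpha^K, G) on Delta_{|K|} x R^m\<close>
    and alpha_meas: "\<And>K. alpha K \<in> borel_measurable Q"
    and alpha_simplex: "\<And>K \<eta>. K \<noteq> {} \<Longrightarrow> K \<subseteq> {..<Nb} \<Longrightarrow> \<eta> \<in> space Q \<Longrightarrow>
                   alpha K \<eta> \<in> simplex_on K"
    and joint: "\<And>K. K \<noteq> {} \<Longrightarrow> K \<subseteq> {..<Nb} \<Longrightarrow>
                   conv_distr M (\<lambda>n \<omega>. (alphan n K \<omega>, (\<lambda>i. r n * (bn n \<omega> i - b i))))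
                              Q (\<lambda>\<eta>. (alpha K \<eta>, G \<eta>))"
  shows "conv_distr M (\<lambda>n \<omega>. (\<lambda>i. r n * (xs n \<omega> i - xstar A c m d b i))) Q
           (\<lambda>\<eta>. (\<lambda>i. \<Sum>K\<in>{K. K \<subseteq> {..<Kb} \<and> K \<noteq> {}}.
               indicator ((\<Inter>k\<in>K. Hcone A m m0 {j. 0 < xstar A c m d b j} (Ib k))
                           - (\<Union>k\<in>{..<Kb} - K. Hcone A m m0 {j. 0 < xstar A c m d b j} (Ib k)))
                         (G \<eta>) * otimes A m Ib K (alpha K \<eta>) (G \<eta>) i))
       \<and> (nondegenerate m d (xstar A c m d b) \<longrightarrow>
            Kb = 1 \<and>
            conv_distr M (\<lambda>n \<omega>. (\<lambda>i. r n * (xs n \<omega> i - xstar A c m d b i))) Q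
              (\<lambda>\<eta>. xsol A m (Ib 0) (G \<eta>)))"
proof -
  interpret M: prob_space M by (rule M_prob)
  interpret Q: prob_space Q by (rule Q_prob)
  define x0 where "x0 = xstar A c m d b"
  define H where "H = (\<lambda>k. Hcone A m m0 {j. 0 < x0 j} (Ib k))"
  \<comment> \<open>The patterns of the extended cones serve for all limits; they agree with those
    of \<open>H\<close> on \<open>vecs m0\<close>, where \<open>G\<close> and \<open>Gn\<close> take
    their values.\<close>
  define S where "S = pattern (\<lambda>k. Hcone_ext A m m0 {j. 0 < x0 j} (Ib k)) Kb"
  define Gn where "Gn = (\<lambda>n \<omega> i. r n * (bn n \<omega> i - b i))"
  define Fn where "Fn = (\<lambda>n \<omega> i. r n * (xs n \<omega> i - x0 i))"
  define active where "active v = {k. k < Kb \<and> v \<in> H k}" for v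
  define lim where "lim = (\<lambda>\<eta> i. \<Sum>K\<in>{K. K \<subseteq> {..<Kb} \<and> K \<noteq> {}}.
      indicator ((\<Inter>k\<in>K. H k) - (\<Union>k\<in>{..<Kb} - K. H k)) (G \<eta>) * otimes A m Ib K (alpha K \<eta>) (G \<eta>) i)"
  have Gn_meas[measurable]: "Gn n \<in> borel_measurable M" for n
    unfolding Gn_def by (rule measurable_scaled_diff[OF bn_meas])
  have Fn_meas[measurable]: "Fn n \<in> borel_measurable M" for n
    unfolding Fn_def by (rule measurable_scaled_diff[OF xs_meas])
  note [measurable] = G_meas alphan_meas alpha_meas
  have G_vecs: "G \<eta> \<in> vecs m0" if "\<eta> \<in> space Q" for \<eta>
    using G_vec[OF that] by (simp add: vecs_def)
  have Gn_vecs: "Gn n \<omega> \<in> vecs m0" if "\<omega> \<in> space M" for n \<omega>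
  proof -
    have "bn n \<omega> i = b i" if "m0 \<le> i" for i
      using bn_fixed[OF \<open>\<omega> \<in> space M\<close> that] bn_vec[OF \<open>\<omega> \<in> space M\<close>, of n] bvec
      by (cases "i < m") (auto simp: vecs_def)
    then show ?thesis by (simp add: vecs_def Gn_def)
  qed
  have S_iff: "v \<in> S K \<longleftrightarrow> v \<in> pattern H Kb K" if "v \<in> vecs m0" for v K
    unfolding S_def H_def using pattern_Hcone_eq_ext[OF that m0(2)] by blast
  have S_sum: "(\<Sum>K\<in>Pow {..<Kb}. indicator (S K) v * h K) = h (active v)" if "v \<in> vecs m0"
    for v and h :: "nat set \<Rightarrow> real"
    unfolding active_def sum_pattern[where T = H and n = Kb and v = v and h = h, symmetric] using S_iff[OF that]
    by (intro sum.cong) (auto simp: indicator_def)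
  have active_sub: "active v \<subseteq> {..<Kb}" for v by (auto simp: active_def)

  have lim_eq: "lim \<eta> = otimes A m Ib (active (G \<eta>)) (alpha (active (G \<eta>)) \<eta>) (G \<eta>)"
    if "\<eta> \<in> space Q" for \<eta>
  proof
    fix i
    have "lim \<eta> i = (\<Sum>K\<in>{K. K \<subseteq> {..<Kb} \<and> K \<noteq> {}}.
        indicator (S K) (G \<eta>) * otimes A m Ib K (alpha K \<eta>) (G \<eta>) i)"
      unfolding lim_def using S_iff[OF G_vecs[OF that]]
      by (intro sum.cong) (auto simp: Inter_minus_Union_eq_pattern indicator_def)
    \<comment> \<open>The term of the empty set vanishes here. Under a test function
      \<open>f\<close> it becomes \<open>f\<close> of the zero vector, so the later sums have to run
      over the full power set.\<close>
    also have "\<dots> = (\<Sum>K\<in>Pow {..<Kb}. indicator (S K) (G \<eta>) * otimes A m Ib K (alpha K \<eta>) (G \<eta>) i)"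
      by (intro sum.mono_neutral_left) (auto simp: otimes_empty)
    finally show "lim \<eta> i = otimes A m Ib (active (G \<eta>)) (alpha (active (G \<eta>)) \<eta>) (G \<eta>) i"
      by (simp add: S_sum[OF G_vecs[OF that]])
  qed

  obtain \<delta> where \<delta>: "0 < \<delta>" and near: "\<And>\<beta> t m0. (\<Sum>l<m. \<bar>\<beta> l - b l\<bar>) < \<delta> \<Longrightarrow> 0 < t \<Longrightarrow> \<beta> \<in> vecs m \<Longrightarrow>
      (\<And>i. m0 \<le> i \<Longrightarrow> i < m \<Longrightarrow> \<beta> i = b i) \<Longrightarrow>
      {k. k < Nb \<and> nonneg_vec d (xsol A m (Ib k) \<beta>)} =
      {k. k < Kb \<and> (\<lambda>i. t * (\<beta> i - b i)) \<in> Hcone A m m0 {j. 0 < xstar A c m d b j} (Ib k)}"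
    using feasible_bases_near[OF bvec enum KN primal A2] by blast
  define E where "E n = {\<omega> \<in> space M. \<exists>x. lp_optimal A c m d (bn n \<omega>) x}" for n
  define s where "s v = (\<Sum>l<m. \<bar>v l\<bar>)" for v :: "nat \<Rightarrow> real"
  \<comment> \<open>As s(G_n) is \<open>r n\<close> times the l1 distance of \<open>bn\<close> and
    \<open>b\<close>, this is the event that \<open>bn\<close> lies outside the radius
    \<delta>.\<close>
  define D where "D n = {\<omega> \<in> space M. \<delta> * r n \<le> s (Gn n \<omega>)}" for n

  have xsol_b: "xsol A m (Ib k) b = x0" if "k < Kb" for k
  proof -
    have "k < Nb" using that KN by simp
    then show ?thesis
      using that primal bij_betwE[OF enum] unfolding x0_def by (intro xstar_eq_xsol[OF A2, symmetric]) auto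
  qed
  have basis_ex: "\<exists>k<Nb. nonneg_vec d (xsol A m (Ib k) \<beta>)" if opt: "lp_optimal A c m d \<beta> x" for \<beta> x
  proof -
    obtain I where I: "dual_feasible_basis A c m d I" "nonneg_vec d (xsol A m I \<beta>)"
      using lp_optimal_imp_optimal_basis[OF rank opt] by blast
    then obtain k where "k < Nb" "I = Ib k" using bij_betw_imp_surj_on[OF enum] by blast
    with I show ?thesis by blast
  qed

  have Fn_eq: "Fn n \<omega> = otimes A m Ib (active (Gn n \<omega>)) (alphan n (active (Gn n \<omega>)) \<omega>) (Gn n \<omega>)"
    if "\<omega> \<in> E n" "\<omega> \<notin> D n" for n \<omega>
  proof -
    have \<omega>: "\<omega> \<in> space M" using that by (simp add: E_def)
    have "s (Gn n \<omega>) = r n * (\<Sum>l<m. \<bar>bn n \<omega> l - b l\<bar>)"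
      using r_pos[of n] by (simp add: s_def Gn_def abs_mult sum_distrib_left)
    then have "(\<Sum>l<m. \<bar>bn n \<omega> l - b l\<bar>) < \<delta>"
      using that(2) \<omega> r_pos[of n] by (simp add: D_def not_le mult.commute)
    then have K: "{k. k < Nb \<and> nonneg_vec d (xsol A m (Ib k) (bn n \<omega>))} = active (Gn n \<omega>)"
      unfolding active_def H_def Gn_def x0_def using \<omega> r_pos bn_vec bn_fixed by (intro near) auto
    define L where "L = active (Gn n \<omega>)"
    have L: "L \<noteq> {}" "L \<subseteq> {..<Nb}"
      using that(1) basis_ex unfolding L_def K[symmetric] E_def by auto
    have "xs n \<omega> = otimes A m Ib L (alphan n L \<omega>) (bn n \<omega>)"
      by (rule alphan_weights[OF L \<omega>]) (simp add: K L_def)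
    moreover have "(\<lambda>i. r n * (otimes A m Ib L (alphan n L \<omega>) (bn n \<omega>) i - x0 i)) =
        otimes A m Ib L (alphan n L \<omega>) (\<lambda>i. r n * (bn n \<omega> i - b i))"
    proof (rule scaled_error_eq_otimes)
      show "finite L" using L(2) finite_subset by blast
      show "alphan n L \<omega> \<in> simplex_on L" by (rule alphan_simplex[OF L \<omega>])
      show "xsol A m (Ib k) b = x0" if "k \<in> L" for k
        using that by (intro xsol_b) (simp add: L_def active_def)
    qed
    ultimately show ?thesis by (simp add: Fn_def flip: L_def) (simp add: Gn_def)
  qed

  have D: "(\<lambda>n. measure M (D n)) \<longlonglongrightarrow> 0"
    unfolding D_def
  proof (rule conv_distr_tight[where X = Gn and Y = G and N = Q and s = s])
    show "conv_distr M Gn Q G" using B1 by (simp add: Gn_def)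
    show "continuous_on UNIV s"
      unfolding s_def by (intro continuous_intros continuous_on_product_coordinates)
    show "filterlim (\<lambda>n. \<delta> * r n) at_top sequentially"
      by (rule filterlim_tendsto_pos_mult_at_top[OF tendsto_const \<delta> r_lim])
  qed (simp_all add: M_prob Q_prob Gn_meas G_meas)
  have E: "(\<lambda>n. measure M (E n)) \<longlonglongrightarrow> 1" using B2 by (simp add: E_def)
  have s_meas: "s \<in> borel_measurable borel"
    unfolding s_def by measurable
  have D_sets: "D n \<in> sets M" for n
    unfolding D_def using s_meas by measurable

  have main: "conv_distr M Fn Q lim"
    unfolding conv_distr_def
  proof (intro allI impI, elim conjE)
    fix f :: "(nat \<Rightarrow> real) \<Rightarrow> real"
    assume f: "continuous_on UNIV f" and "bounded (range f)"
    then obtain B where B: "\<bar>f x\<bar> \<le> B" for x by (auto simp: bounded_iff)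
    have B0: "0 \<le> B" using B[of undefined] by linarith
    have f_meas[measurable]: "f \<in> borel_measurable borel" using f by (rule borel_measurable_continuous_onI)
    have gen: "AE \<eta> in Q. \<forall>k<Kb. \<forall>j<m. (\<forall>l<m0. inv_sq m (colsub A (Ib k)) j l = 0) \<or>
        (\<Sum>l<m0. inv_sq m (colsub A (Ib k)) j l * G \<eta> l) \<noteq> 0"
      by (rule AE_constraints_generic[OF G_meas G_ac])
    define tn where "tn n K \<omega> = indicator (S K) (Gn n \<omega>) * f (otimes A m Ib K (alphan n K \<omega>) (Gn n \<omega>))"
      for n K \<omega>
    define tl where "tl K \<eta> = indicator (S K) (G \<eta>) * f (otimes A m Ib K (alpha K \<eta>) (G \<eta>))" for K \<eta>
    have S_meas[measurable]: "S K \<in> sets borel" for K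
      unfolding S_def by (rule pattern_Hcone_ext_measurable)
    have fo_meas[measurable]: "(\<lambda>p. f (otimes A m Ib K (fst p) (snd p))) \<in> borel_measurable borel" for K
      by (intro borel_measurable_continuous_onI continuous_on_compose2[OF f continuous_on_otimes]) simp
    have tn_meas[measurable]: "tn n K \<in> borel_measurable M" for n K
    proof -
      have "(\<lambda>\<omega>. (alphan n K \<omega>, Gn n \<omega>)) \<in> borel_measurable M" by measurable
      from measurable_compose[OF this fo_meas[of K]] show ?thesis
        unfolding tn_def by simp
    qed
    have tl_meas[measurable]: "tl K \<in> borel_measurable Q" for K
    proof -
      have "(\<lambda>\<eta>. (alpha K \<eta>, G \<eta>)) \<in> borel_measurable Q" by measurable
      from measurable_compose[OF this fo_meas[of K]] show ?thesis
        unfolding tl_def by simp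
    qed
    have int: "integrable M (tn n K)" "integrable Q (tl K)" for n K
      using B B0 by (auto intro!: M.integrable_const_bound[where B = B] Q.integrable_const_bound[where B = B]
          simp: tn_def tl_def indicator_def)

    have conv: "(\<lambda>n. \<integral>\<omega>. tn n K \<omega> \<partial>M) \<longlonglongrightarrow> (\<integral>\<eta>. tl K \<eta> \<partial>Q)" if K: "K \<in> Pow {..<Kb}" for K
    proof -
      \<comment> \<open>The weights are irrelevant for \<open>K = {}\<close>, where any of the given joint limits can be used.\<close>
      define L where "L = (if K = {} then {..<Nb} else K)"
      obtain x where "lp_optimal A c m d b x" using A2 by blast
      then have "Nb \<noteq> 0" using basis_ex by fastforce
      then have L: "L \<noteq> {}" "L \<subseteq> {..<Nb}" using K KN by (auto simp: L_def)
      have same: "otimes A m Ib K (w L) v = otimes A m Ib K (w K) v" for w v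
        by (simp add: L_def otimes_empty)
      have J: "conv_distr M (\<lambda>n \<omega>. (alphan n L \<omega>, Gn n \<omega>)) Q (\<lambda>\<eta>. (alpha L \<eta>, G \<eta>))"
        using joint[OF L] by (simp add: Gn_def)
      have "(\<lambda>n. \<integral>\<omega>. indicator (S K) (Gn n \<omega>) * f (otimes A m Ib K (alphan n L \<omega>) (Gn n \<omega>)) \<partial>M) \<longlonglongrightarrow>
        (\<integral>\<eta>. indicator (S K) (G \<eta>) * f (otimes A m Ib K (alpha L \<eta>) (G \<eta>)) \<partial>Q)"
        unfolding S_def
        by (rule conv_distr_pattern[OF J M_prob Q_prob alphan_meas Gn_meas alpha_meas G_meas f B gen])
      then show ?thesis
        unfolding tn_def tl_def
        using same[of "\<lambda>K. alphan _ K _"] same[of "\<lambda>K. alpha K _"] by simp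
    qed

    have "(\<lambda>n. \<Sum>K\<in>Pow {..<Kb}. \<integral>\<omega>. tn n K \<omega> \<partial>M) \<longlonglongrightarrow> (\<Sum>K\<in>Pow {..<Kb}. \<integral>\<eta>. tl K \<eta> \<partial>Q)"
      by (intro tendsto_sum conv)
    then have lim_sum: "(\<lambda>n. \<integral>\<omega>. (\<Sum>K\<in>Pow {..<Kb}. tn n K \<omega>) \<partial>M) \<longlonglongrightarrow> (\<integral>\<eta>. (\<Sum>K\<in>Pow {..<Kb}. tl K \<eta>) \<partial>Q)"
      using int by simp
    have tn_sum: "(\<Sum>K\<in>Pow {..<Kb}. tn n K \<omega>) =
        f (otimes A m Ib (active (Gn n \<omega>)) (alphan n (active (Gn n \<omega>)) \<omega>) (Gn n \<omega>))"
      if "\<omega> \<in> space M" for n \<omega>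
      unfolding tn_def by (rule S_sum[OF Gn_vecs[OF that]])
    have "(\<Sum>K\<in>Pow {..<Kb}. tl K \<eta>) = f (lim \<eta>)" if "\<eta> \<in> space Q" for \<eta>
      unfolding tl_def lim_eq[OF that] by (rule S_sum[OF G_vecs[OF that]])
    then have "(\<integral>\<eta>. (\<Sum>K\<in>Pow {..<Kb}. tl K \<eta>) \<partial>Q) = (\<integral>\<eta>. f (lim \<eta>) \<partial>Q)"
      by (intro Bochner_Integration.integral_cong) auto
    \<comment> \<open>\<open>tn_sum\<close>, and with it the bound \<open>B\<close>, is available on
      \<open>space M\<close> only, whereas the comparison lemma wants a bound at every point; hence
      the value 0 elsewhere.\<close>
    moreover define T where "T n \<omega> = (if \<omega> \<in> space M then \<Sum>K\<in>Pow {..<Kb}. tn n K \<omega> else 0)" for n \<omega>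
    have "(\<integral>\<omega>. (\<Sum>K\<in>Pow {..<Kb}. tn n K \<omega>) \<partial>M) = (\<integral>\<omega>. T n \<omega> \<partial>M)" for n
      by (intro Bochner_Integration.integral_cong) (auto simp: T_def)
    ultimately have T_lim: "(\<lambda>n. \<integral>\<omega>. T n \<omega> \<partial>M) \<longlonglongrightarrow> (\<integral>\<eta>. f (lim \<eta>) \<partial>Q)"
      using lim_sum by simp
    have "(\<lambda>n. (\<integral>\<omega>. f (Fn n \<omega>) \<partial>M) - (\<integral>\<omega>. T n \<omega> \<partial>M)) \<longlonglongrightarrow> 0"
    proof (rule integral_difference_tendsto_0[OF M_prob])
      show "T n \<in> borel_measurable M" for n
        unfolding T_def by (rule measurable_If_set) auto
      show "\<bar>T n \<omega>\<bar> \<le> B" for n \<omega> using B B0 by (simp add: T_def tn_sum)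
      show "f (Fn n \<omega>) = T n \<omega>" if "\<omega> \<in> E n" "\<omega> \<notin> D n" for n \<omega>
        using Fn_eq[OF that] that(1) by (simp add: T_def tn_sum E_def)
      show "E n \<subseteq> space M" for n by (auto simp: E_def)
    qed (use B E D D_sets in auto)
    from tendsto_add[OF this T_lim]
    show "(\<lambda>n. \<integral>\<omega>. f (Fn n \<omega>) \<partial>M) \<longlonglongrightarrow> (\<integral>\<eta>. f (lim \<eta>) \<partial>Q)" by simp
  qed

  have "Kb = 1 \<and> conv_distr M Fn Q (\<lambda>\<eta>. xsol A m (Ib 0) (G \<eta>))" if nondeg: "nondegenerate m d x0"
  proof -
    note unique = nondegenerate_unique_basis[OF rank enum KN primal A2 nondeg[unfolded x0_def], folded x0_def]
    have Kb: "Kb = 1" by (rule unique(1))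
    have basis: "is_basis A m d (Ib 0)"
      using bij_betwE[OF enum] Kb KN by (auto simp: dual_feasible_basis_def)
    \<comment> \<open>All basic indices are positive coordinates of \<open>x0\<close>, so the cone
      imposes no inequality beyond membership in \<open>vecs m0\<close>. The pattern is then always
      {0}, whose only weight is 1.\<close>
    have "v \<in> H 0" if "v \<in> vecs m0" for v
      using that is_basis_idx_mem[OF basis] unique(2) by (auto simp: H_def Hcone_def)
    then have active: "active (G \<eta>) = {0}" if "\<eta> \<in> space Q" for \<eta>
      using G_vecs[OF that] Kb by (auto simp: active_def)
    have "lim \<eta> = xsol A m (Ib 0) (G \<eta>)" if "\<eta> \<in> space Q" for \<eta>
      using alpha_simplex[of "{0}", OF _ _ that] Kb KN
      by (simp add: lim_eq[OF that] active[OF that] otimes_def simplex_on_def)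
    then have "conv_distr M Fn Q lim \<longleftrightarrow> conv_distr M Fn Q (\<lambda>\<eta>. xsol A m (Ib 0) (G \<eta>))"
      by (rule conv_distr_limit_cong)
    with main Kb show ?thesis by simp
  qed
  with main show ?thesis unfolding Fn_def lim_def H_def x0_def by blast
qed

end
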